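(* Let $(\Omega,\mathcal F,\mathsf P)$ be a probability space carrying two sequences of real-valued random variables $(X_n)_{n\ge1}$ and $(Y_n)_{n\ge1}$. Assume the following. (i) The random variables $(X_n)_{n\ge 1}$ are pairwise independent and have finite expectations, with $\mathsf E X_n=0$ for all $n\ge1$. (ii) There exists an integer $n_0\ge1$ such that $$\int_{0}^{\infty}\ \sup_{n\ge n_0}\ \frac1n\sum_{k=n_0}^{n}\mathsf P(|X_k|>x)\,dx<\infty .$$ (iii) There is a nonrandom sequence $(a_n)_{n\ge1}$ with $a_n>0$ for all $n$ and $a_n\downarrow0$ as $n\to\infty$, such that $V_n:=|Y_n|^{a_n}$ satisfies $\mathsf E V_n<\infty$ for all $n\ge1$. (No assumption is made on the dependence structure of $(Y_n)$ or on the joint dependence of $(X_n)$ and $(Y_n)$, and the $Y_n$ need not have finite expectations.) (iv) There is a nonincreasing function $\bar G:[0,\infty)\to[0,\infty)$ such that $$\sup_{n\ge1}\mathsf P(V_n>t)\le \bar G(t)\quad\text{for all }t\ge0,\qquad \int_0^\infty \bar G(t)\,dt<\infty .$$ (v) $(\alpha_n)_{n\ge1}$ is a nonrandom sequence with values in $\{0,1\}$; put $\varphi_n:=\sum_{k=1}^n\alpha_k$ and $\psi_n:=n-\varphi_n$. Assume $\varphi_n\to\infty$ as $n\to\infty$ and $$\limsup_{n\to\infty}\frac{\varphi_n^{1/a_{\varphi_n}}}{n}<\infty .$$ Define, for $n\ge1$, $Z_n:=Y_{\varphi_n}$ if $\alpha_n=1$ and $Z_n:=X_{\psi_n}$ if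 $\alpha_n=0$. Then $$\frac1n\sum_{k=1}^n Z_k\longrightarrow 0\quad\text{almost surely as }n\to\infty .$$
   Context: $\mathsf P$ denotes probability and $\mathsf E$ expectation. The notation $a_n\downarrow 0$ means that $(a_n)$ is nonincreasing and converges to $0$. The sequence $(Z_n)$ interleaves $(X_n)$ and $(Y_n)$: $\varphi_n$ is the number of $Y$-terms and $\psi_n$ the number of $X$-terms among $Z_1,\dots,Z_n$. Since $\varphi_n\to\infty$, $\varphi_n\ge1$ for all large $n$, so the expression $\varphi_n^{1/a_{\varphi_n}}$ in the limsup is defined for all large $n$. *)

theory Defs
  imports "HOL-Probability.Probability"
begin

text \<open>
  All sequences are indexed by the positive integers; values at index 0 are never constrained and
  do not influence anything below.  The selector \<open>\<alpha>\<close> takes the values 0 and 1.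
\<close>

definition num_Y :: "(nat \<Rightarrow> nat) \<Rightarrow> nat \<Rightarrow> nat" where
  "num_Y \<alpha> n = (\<Sum>k=1..n. \<alpha> k)"

text \<open>
  The subtraction is on natural numbers, but it does not truncate for a 0-1-valued \<open>\<alpha>\<close>, since then
  \<open>num_Y \<alpha> n \<le> n\<close>.
\<close>

definition num_X :: "(nat \<Rightarrow> nat) \<Rightarrow> nat \<Rightarrow> nat" where
  "num_X \<alpha> n = n - num_Y \<alpha> n"

definition interleave ::
  "(nat \<Rightarrow> nat) \<Rightarrow> (nat \<Rightarrow> 'a \<Rightarrow> real) \<Rightarrow> (nat \<Rightarrow> 'a \<Rightarrow> real) \<Rightarrow> nat \<Rightarrow> 'a \<Rightarrow> real" where
  "interleave \<alpha> X Y n = (if \<alpha> n = 1 then Y (num_Y \<alpha> n) else X (num_X \<alpha> n))"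

end

theory Submission
  imports Defs
begin

text \<open>
  The average of the \<open>Z k\<close> splits into a sum of \<open>X\<close>-terms and a sum of \<open>Y\<close>-terms, both divided by \<open>n\<close>,
  and both vanish almost surely for reasons rooted in one computation. If the averaged tails of a
  nonnegative sequence \<open>U\<close> lie below an integrable function \<open>H\<close>, then for every \<open>q > 1\<close> the second
  moments of \<open>U k\<close> truncated at \<open>q ^ i\<close>, summed over \<open>k \<le> q ^ i\<close> and divided by \<open>(q ^ i)\<^sup>2\<close>, have a finite
  sum over \<open>i\<close> (\<open>sum_truncated_second_moments\<close>, \<open>geometric_second_moments_finite\<close>). This rests on the
  tails of the individual variables alone, hence applies to arbitrarily dependent \<open>V j\<close> as well. With \<open>q = 2\<close> it shows that the squares of \<open>min (U k / k) 1\<close> are almost surely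
  summable (\<open>capped_ratio_squares_summable\<close>); in particular \<open>U k < k\<close> for all large \<open>k\<close>.

  For the \<open>X\<close>-terms this is Etemadi's proof of the strong law, applied to positive and negative parts.
  The variables are truncated at their index. Pairwise independence bounds the variance of a sum by the
  sum of second moments, so the centred truncated sums, normalised, tend to 0 along \<open>q ^ i\<close>; and since
  the partial sums are monotone, the gaps of this subsequence can be filled. Under identical
  distribution the means on a block are bounded trivially. Here they are not, and the bound comes
  from Cesaro uniform integrability: up to a small average excess every term is at most a level \<open>c\<close>, and
  \<open>q\<close> is chosen close to 1 depending on \<open>c\<close> (\<open>trunc_expectation_growth\<close>, \<open>trunc_slln\<close>). The result is
  \<open>centred_pairwise_indep_slln\<close>. As at most \<open>n\<close> of the first \<open>n\<close> terms are \<open>X\<close>-terms, it gives the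
  claim for this part (\<open>delayed_average_tendsto_zero\<close>).

  For the \<open>Y\<close>-terms write \<open>\<bar>Y j\<bar> = V j powr p j\<close> with \<open>p j = 1 / a j\<close>, which increases to infinity. As soon as
  \<open>p j \<ge> 2\<close> and \<open>V j < j\<close>, the ratio of \<open>\<bar>Y j\<bar>\<close> to \<open>j powr p j\<close> is at most \<open>(V j / j)\<^sup>2\<close>, which is summable by the
  above. Kronecker's lemma then shows that the sum of the first \<open>m\<close> terms is negligible against
  \<open>m powr p m\<close> (\<open>sum_growing_powers_negligible\<close>), and for \<open>m = num_Y \<alpha> n\<close> the growth condition says that this
  weight is at most a constant times \<open>n\<close>.
\<close>

section \<open>Layer-cake formulas\<close>

text \<open>
  Applied to squares, this form of monotone convergence turns summable second moments directly into
  almost sure convergence to 0, in place of Chebyshev's inequality and the Borel--Cantelli lemma.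
\<close>

lemma summable_if_nn_suminf_finite:
  fixes f :: "nat \<Rightarrow> 'a \<Rightarrow> real"
  assumes [measurable]: "\<And>i. f i \<in> borel_measurable M"
    and nonneg: "\<And>i \<omega>. 0 \<le> f i \<omega>"
    and fin: "(\<Sum>i. \<integral>\<^sup>+\<omega>. ennreal (f i \<omega>) \<partial>M) < \<infinity>"
  shows "AE \<omega> in M. summable (\<lambda>i. f i \<omega>)"
proof -
  have "(\<integral>\<^sup>+\<omega>. (\<Sum>i. ennreal (f i \<omega>)) \<partial>M) \<noteq> \<infinity>"
    using fin by (subst nn_integral_suminf) auto
  then have "AE \<omega> in M. (\<Sum>i. ennreal (f i \<omega>)) \<noteq> \<infinity>"
    by (intro nn_integral_PInf_AE) auto
  then show ?thesis
    by eventually_elim (auto intro: summable_suminf_not_top nonneg)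
qed

text \<open>
  Tail bounds become moment bounds by integrating \<open>indicator {..<U \<omega>} t\<close> against a weight \<open>w\<close> and
  exchanging the integrals. The weights used below are \<open>2 t\<close> on \<open>{0..r}\<close>, which yields the squared
  truncation \<open>(min U r)\<^sup>2\<close>, and the indicator of \<open>{c..}\<close>, which yields the excess \<open>U - min U c\<close>.
\<close>

lemma layer_cake:
  fixes U :: "'a \<Rightarrow> real" and w :: "real \<Rightarrow> ennreal"
  assumes "sigma_finite_measure M" and [measurable]: "U \<in> borel_measurable M" "w \<in> borel_measurable borel"
  shows "(\<integral>\<^sup>+\<omega>. (\<integral>\<^sup>+t. w t * indicator {..<U \<omega>} t \<partial>lborel) \<partial>M)
       = (\<integral>\<^sup>+t. w t * emeasure M {\<omega>\<in>space M. t < U \<omega>} \<partial>lborel)"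
proof -
  interpret M: sigma_finite_measure M by fact
  interpret pair_sigma_finite M lborel ..
  have "(\<integral>\<^sup>+\<omega>. (\<integral>\<^sup>+t. w t * indicator {..<U \<omega>} t \<partial>lborel) \<partial>M)
      = (\<integral>\<^sup>+t. (\<integral>\<^sup>+\<omega>. w t * indicator {..<U \<omega>} t \<partial>M) \<partial>lborel)"
    by (rule Fubini'[symmetric]) (simp add: indicator_def)
  also have "\<dots> = (\<integral>\<^sup>+t. w t * emeasure M {\<omega>\<in>space M. t < U \<omega>} \<partial>lborel)"
  proof (rule nn_integral_cong)
    fix t :: real
    have "(\<integral>\<^sup>+\<omega>. w t * indicator {..<U \<omega>} t \<partial>M) = w t * (\<integral>\<^sup>+\<omega>. indicator {..<U \<omega>} t \<partial>M)"
      by (rule nn_integral_cmult) (simp add: indicator_def)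
    also have "(\<integral>\<^sup>+\<omega>. indicator {..<U \<omega>} t \<partial>M) = (\<integral>\<^sup>+\<omega>. indicator {\<omega>\<in>space M. t < U \<omega>} \<omega> \<partial>M)"
      by (rule nn_integral_cong) (simp add: indicator_def)
    finally show "(\<integral>\<^sup>+\<omega>. w t * indicator {..<U \<omega>} t \<partial>M) = w t * emeasure M {\<omega>\<in>space M. t < U \<omega>}"
      by simp
  qed
  finally show ?thesis .
qed

lemma nn_integral_twice_Icc:
  assumes "0 \<le> (s::real)"
  shows "(\<integral>\<^sup>+t. ennreal (2 * t) * indicator {0..s} t \<partial>lborel) = ennreal (s\<^sup>2)"
proof -
  have "(\<integral>\<^sup>+t. ennreal (2 * t) * indicator {0..s} t \<partial>lborel) = ennreal (s\<^sup>2 - 0\<^sup>2)"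
    by (rule nn_integral_FTC_Icc) (use assms in \<open>auto intro!: derivative_eq_intros\<close>)
  then show ?thesis by simp
qed

lemma min_square_layers:
  fixes u r :: real
  assumes "0 \<le> u" "0 \<le> r"
  shows "(\<integral>\<^sup>+t. (ennreal (2 * t) * indicator {0..r} t) * indicator {..<u} t \<partial>lborel) = ennreal ((min u r)\<^sup>2)"
proof -
  have "AE t in lborel. t \<noteq> u"
    by (rule AE_lborel_singleton)
  then have "AE t in lborel. (ennreal (2 * t) * indicator {0..r} t) * indicator {..<u} t
      = ennreal (2 * t) * indicator {0..min u r} t"
    by eventually_elim (auto split: split_indicator)
  then have "(\<integral>\<^sup>+t. (ennreal (2 * t) * indicator {0..r} t) * indicator {..<u} t \<partial>lborel)
      = (\<integral>\<^sup>+t. ennreal (2 * t) * indicator {0..min u r} t \<partial>lborel)"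
    by (rule nn_integral_cong_AE)
  then show ?thesis
    using nn_integral_twice_Icc[of "min u r"] assms by simp
qed

lemma excess_layers:
  fixes u c :: real
  shows "(\<integral>\<^sup>+t. indicator {c..} t * indicator {..<u} t \<partial>lborel) = ennreal (u - min u c)"
proof -
  have "(\<integral>\<^sup>+t. indicator {c..} t * indicator {..<u} t \<partial>lborel) = (\<integral>\<^sup>+t. indicator {c..<u} t \<partial>lborel)"
    by (rule nn_integral_cong) (auto split: split_indicator)
  also have "\<dots> = ennreal (u - min u c)"
    by (cases "c \<le> u") (auto simp: min_def)
  finally show ?thesis .
qed

text \<open>
  Only the indices with \<open>q ^ i \<ge> t\<close> contribute. The first such term is at most 2 because
  \<open>t / q ^ i \<le> 1\<close> there, and from then on the terms decay geometrically with ratio \<open>1 / q\<close>. The bound is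
  independent of \<open>t\<close>, so a sum of truncated second moments along \<open>q ^ i\<close> costs no more than one first
  moment.
\<close>

lemma truncated_geometric_sum:
  fixes q t :: real
  assumes "1 < q" "0 \<le> t"
  shows "(\<Sum>i. ennreal (1 / q ^ i) * (ennreal (2 * t) * indicator {0..q ^ i} t)) \<le> ennreal (2 * q / (q - 1))"
proof -
  obtain j0 where j0: "t < q ^ j0"
    using real_arch_pow[OF assms(1), of t] by auto
  define j where "j = (LEAST i. t \<le> q ^ i)"
  have j: "t \<le> q ^ j"
    unfolding j_def by (rule LeastI[of _ j0]) (use j0 in simp)
  have below: "i < j \<Longrightarrow> q ^ i < t" for i
    unfolding j_def using not_less_Least[of i "\<lambda>i. t \<le> q ^ i"] by auto
  have le: "ennreal (1 / q ^ i) * (ennreal (2 * t) * indicator {0..q ^ i} t)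
      \<le> ennreal (if i < j then 0 else 2 * (1 / q) ^ (i - j))" for i
  proof (cases "i < j")
    case True
    then show ?thesis using below[of i] by simp
  next
    case False
    then have "q ^ i = q ^ j * q ^ (i - j)"
      by (simp flip: power_add)
    then have "1 / q ^ i * (2 * t) \<le> 2 * (1 / q) ^ (i - j)"
      using j assms by (simp add: field_simps)
    then have "ennreal (1 / q ^ i) * ennreal (2 * t) \<le> ennreal (2 * (1 / q) ^ (i - j))"
      using assms by (simp flip: ennreal_mult add: ennreal_leI)
    then show ?thesis using False
      by (auto split: split_indicator)
  qed
  have geo: "(\<lambda>i. 2 * (1 / q) ^ i) sums (2 * (1 / (1 - 1 / q)))"
    by (intro sums_mult geometric_sums) (use assms in simp)
  have "(\<lambda>i. (if i + j < j then 0 else 2 * (1 / q) ^ (i + j - j))) sums (2 * (1 / (1 - 1 / q)))"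
    using geo by simp
  then have "(\<lambda>i. (if i < j then 0 else 2 * (1 / q) ^ (i - j))) sums (2 * (1 / (1 - 1 / q)))"
    by (subst (asm) sums_iff_shift) simp
  then have *: "(\<lambda>i. ennreal (if i < j then 0 else 2 * (1 / q) ^ (i - j))) sums ennreal (2 * (1 / (1 - 1 / q)))"
    using assms by (subst sums_ennreal) (auto intro!: divide_nonneg_nonneg)
  have "(\<Sum>i. ennreal (1 / q ^ i) * (ennreal (2 * t) * indicator {0..q ^ i} t))
      \<le> (\<Sum>i. ennreal (if i < j then 0 else 2 * (1 / q) ^ (i - j)))"
    by (intro suminf_le le) auto
  also have "\<dots> = ennreal (2 * (1 / (1 - 1 / q)))"
    using * by (rule sums_unique[symmetric])
  also have "2 * (1 / (1 - 1 / q)) = 2 * q / (q - 1)"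
    using assms by (simp add: field_simps)
  finally show ?thesis .
qed

section \<open>Sequences with averaged tails dominated by an integrable function\<close>

text \<open>
  Both halves of the theorem run on this one hypothesis: the averaged tails of a nonnegative sequence
  lie below an integrable function. Averages start at index 1, so a sequence given from index 1 on can be
  extended by \<open>U 0 = 0\<close>. The bound \<open>H\<close> takes values in the extended nonnegative reals since it is in
  one application a supremum of averaged tails.
\<close>

locale cesaro_dominated = prob_space M for M :: "'a measure" +
  fixes U :: "nat \<Rightarrow> 'a \<Rightarrow> real" and H :: "real \<Rightarrow> ennreal"
  assumes rv [measurable]: "\<And>k. U k \<in> borel_measurable M"
    and nonneg: "\<And>k \<omega>. 0 \<le> U k \<omega>"
    and H_measurable [measurable]: "H \<in> borel_measurable borel"
    and H_integrable: "(\<integral>\<^sup>+t. H t * indicator {0..} t \<partial>lborel) < \<infinity>"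
    and dominated: "\<And>n t. 0 \<le> t \<Longrightarrow> (\<Sum>k=1..n. emeasure M {\<omega>\<in>space M. t < U k \<omega>}) \<le> of_nat n * H t"
begin

lemma sum_layers_le:
  assumes [measurable]: "w \<in> borel_measurable borel" and w0: "\<And>t. t < 0 \<Longrightarrow> w t = 0"
  shows "(\<Sum>k=1..n. \<integral>\<^sup>+\<omega>. (\<integral>\<^sup>+t. w t * indicator {..<U k \<omega>} t \<partial>lborel) \<partial>M)
    \<le> of_nat n * (\<integral>\<^sup>+t. w t * H t \<partial>lborel)"
proof -
  have [measurable]: "(\<lambda>t. emeasure M {\<omega>\<in>space M. t < U k \<omega>}) \<in> borel_measurable borel" for k
    by measurable
  have "(\<Sum>k=1..n. \<integral>\<^sup>+\<omega>. (\<integral>\<^sup>+t. w t * indicator {..<U k \<omega>} t \<partial>lborel) \<partial>M)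
      = (\<Sum>k=1..n. \<integral>\<^sup>+t. w t * emeasure M {\<omega>\<in>space M. t < U k \<omega>} \<partial>lborel)"
    by (simp add: layer_cake sigma_finite_measure_axioms)
  also have "\<dots> = (\<integral>\<^sup>+t. (\<Sum>k=1..n. w t * emeasure M {\<omega>\<in>space M. t < U k \<omega>}) \<partial>lborel)"
    by (rule nn_integral_sum[symmetric]) measurable
  also have "\<dots> \<le> (\<integral>\<^sup>+t. of_nat n * (w t * H t) \<partial>lborel)"
  proof (rule nn_integral_mono)
    fix t :: real
    show "(\<Sum>k=1..n. w t * emeasure M {\<omega>\<in>space M. t < U k \<omega>}) \<le> of_nat n * (w t * H t)"
    proof (cases "t < 0")
      case False
      then show ?thesis
        using mult_left_mono[OF dominated[of t n], of "w t"] by (simp add: sum_distrib_left ac_simps)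
    qed (simp add: w0)
  qed
  also have "\<dots> = of_nat n * (\<integral>\<^sup>+t. w t * H t \<partial>lborel)"
    by (rule nn_integral_cmult) measurable
  finally show ?thesis .
qed

lemma sum_truncated_second_moments:
  assumes "0 \<le> r"
  shows "(\<Sum>k=1..n. \<integral>\<^sup>+\<omega>. ennreal ((min (U k \<omega>) r)\<^sup>2) \<partial>M)
    \<le> of_nat n * (\<integral>\<^sup>+t. (ennreal (2 * t) * indicator {0..r} t) * H t \<partial>lborel)"
  using sum_layers_le[of "\<lambda>t. ennreal (2 * t) * indicator {0..r} t" n] assms
  by (simp add: min_square_layers nonneg)

lemma sum_excess_means:
  assumes "0 \<le> c"
  shows "(\<Sum>k=1..n. \<integral>\<^sup>+\<omega>. ennreal (U k \<omega> - min (U k \<omega>) c) \<partial>M)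
    \<le> of_nat n * (\<integral>\<^sup>+t. indicator {c..} t * H t \<partial>lborel)"
  using sum_layers_le[of "indicator {c..}" n] assms
  by (simp add: excess_layers)

text \<open>
  After dividing by \<open>(q ^ i)\<^sup>2\<close>, the truncated second moments of the first \<open>q ^ i\<close> terms are at most the
  summand here, by \<open>sum_truncated_second_moments\<close>. Exchanging sum and integral leaves
  \<open>truncated_geometric_sum\<close> under the integral, hence a constant times the integral of \<open>H\<close>.
\<close>

lemma geometric_second_moments_finite:
  assumes "1 < q"
  shows "(\<Sum>i. ennreal (1 / q ^ i) * (\<integral>\<^sup>+t. (ennreal (2 * t) * indicator {0..q ^ i} t) * H t \<partial>lborel)) < \<infinity>"
proof -
  have "(\<Sum>i. ennreal (1 / q ^ i) * (\<integral>\<^sup>+t. (ennreal (2 * t) * indicator {0..q ^ i} t) * H t \<partial>lborel))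
      = (\<Sum>i. \<integral>\<^sup>+t. ennreal (1 / q ^ i) * ((ennreal (2 * t) * indicator {0..q ^ i} t) * H t) \<partial>lborel)"
    by (subst nn_integral_cmult) auto
  also have "\<dots> = (\<integral>\<^sup>+t. (\<Sum>i. ennreal (1 / q ^ i) * ((ennreal (2 * t) * indicator {0..q ^ i} t) * H t)) \<partial>lborel)"
    by (rule nn_integral_suminf[symmetric]) measurable
  also have "\<dots> \<le> (\<integral>\<^sup>+t. ennreal (2 * q / (q - 1)) * (H t * indicator {0..} t) \<partial>lborel)"
  proof (rule nn_integral_mono)
    fix t :: real
    show "(\<Sum>i. ennreal (1 / q ^ i) * ((ennreal (2 * t) * indicator {0..q ^ i} t) * H t))
        \<le> ennreal (2 * q / (q - 1)) * (H t * indicator {0..} t)"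
    proof (cases "0 \<le> t")
      case True
      have "(\<Sum>i. ennreal (1 / q ^ i) * ((ennreal (2 * t) * indicator {0..q ^ i} t) * H t))
          = (\<Sum>i. ennreal (1 / q ^ i) * (ennreal (2 * t) * indicator {0..q ^ i} t)) * H t"
        by (subst ennreal_suminf_multc[symmetric]) (simp add: mult.assoc)
      also have "\<dots> \<le> ennreal (2 * q / (q - 1)) * H t"
        by (intro mult_right_mono truncated_geometric_sum assms True) simp
      finally show ?thesis using True by simp
    qed simp
  qed
  also have "\<dots> = ennreal (2 * q / (q - 1)) * (\<integral>\<^sup>+t. H t * indicator {0..} t \<partial>lborel)"
    by (rule nn_integral_cmult) measurable
  also have "\<dots> < \<infinity>"
    using H_integrable by (simp add: ennreal_mult_less_top)
  finally show ?thesis .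
qed

text \<open>
  With \<open>sum_excess_means\<close> this is uniform integrability in the Cesaro sense: at a high enough level
  \<open>c\<close>, the mean excess over \<open>c\<close> is small on average, uniformly in the number of terms.
\<close>

lemma excess_vanishes:
  assumes "0 < \<epsilon>"
  shows "\<exists>c\<ge>0. (\<integral>\<^sup>+t. indicator {c..} t * H t \<partial>lborel) \<le> ennreal \<epsilon>"
proof -
  have "(\<lambda>n. \<integral>\<^sup>+t. indicator {real n..} t * H t \<partial>lborel) \<longlonglongrightarrow> (\<integral>\<^sup>+t. 0 \<partial>(lborel::real measure))"
  proof (rule nn_integral_dominated_convergence[where w = "\<lambda>t. H t * indicator {0..} t"])
    show "AE t in lborel. (\<lambda>n. indicator {real n..} t * H t) \<longlonglongrightarrow> 0"
    proof (rule AE_I2)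
      fix t :: real
      have "eventually (\<lambda>n. real n > t) sequentially"
        using filterlim_real_sequentially by (auto simp: filterlim_at_top_dense)
      then have "eventually (\<lambda>n. indicator {real n..} t * H t = 0) sequentially"
        by eventually_elim simp
      then show "(\<lambda>n. indicator {real n..} t * H t) \<longlonglongrightarrow> 0"
        by (rule tendsto_eventually)
    qed
  qed (use H_integrable in \<open>auto split: split_indicator\<close>)
  then have "eventually (\<lambda>n. (\<integral>\<^sup>+t. indicator {real n..} t * H t \<partial>lborel) < ennreal \<epsilon>) sequentially"
    using assms by (intro order_tendstoD) auto
  then obtain n where "(\<integral>\<^sup>+t. indicator {real n..} t * H t \<partial>lborel) < ennreal \<epsilon>"
    by (auto simp: eventually_sequentially)
  then show ?thesis
    by (intro exI[of _ "real n"]) auto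
qed

end

section \<open>Deterministic and second-moment tools\<close>

text \<open>
  Independence in pairs makes the centred variables orthogonal, and centring does not increase a second
  moment.
\<close>

lemma (in prob_space) second_moment_sum_pairwise_indep:
  fixes Z :: "nat \<Rightarrow> 'a \<Rightarrow> real" and B :: "nat \<Rightarrow> real"
  assumes "finite I" and [measurable]: "\<And>k. Z k \<in> borel_measurable M"
    and bound: "\<And>k \<omega>. \<bar>Z k \<omega>\<bar> \<le> B k"
    and indep: "\<And>k l. k \<noteq> l \<Longrightarrow> indep_var borel (Z k) borel (Z l)"
  shows "(\<integral>\<^sup>+\<omega>. ennreal ((\<Sum>k\<in>I. Z k \<omega> - expectation (Z k))\<^sup>2) \<partial>M)
    \<le> (\<Sum>k\<in>I. \<integral>\<^sup>+\<omega>. ennreal ((Z k \<omega>)\<^sup>2) \<partial>M)"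
proof -
  define W where "W k \<omega> = Z k \<omega> - expectation (Z k)" for k \<omega>
  have W_meas [measurable]: "W k \<in> borel_measurable M" for k
    unfolding W_def by measurable
  have Z_int: "integrable M (Z k)" for k
    by (rule integrable_const_bound[where B = "B k"]) (auto simp: bound)
  have Z2_int: "integrable M (\<lambda>\<omega>. (Z k \<omega>)\<^sup>2)" for k
  proof (rule integrable_const_bound[where B = "(B k)\<^sup>2"])
    have "\<bar>Z k \<omega>\<bar>\<^sup>2 \<le> (B k)\<^sup>2" for \<omega>
      by (rule power_mono[OF bound]) simp
    then show "AE \<omega> in M. norm ((Z k \<omega>)\<^sup>2) \<le> (B k)\<^sup>2"
      by simp
  qed simp
  have W_int: "integrable M (W k)" for k
    unfolding W_def using Z_int by simp
  have W_bound: "\<bar>W k \<omega>\<bar> \<le> B k + \<bar>expectation (Z k)\<bar>" for k \<omega>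
    unfolding W_def using bound[of k \<omega>] by linarith
  have B0: "0 \<le> B k" for k
    using bound[of k undefined] by linarith
  have prod_int: "integrable M (\<lambda>\<omega>. W k \<omega> * W l \<omega>)" for k l
  proof (rule integrable_const_bound[where B = "(B k + \<bar>expectation (Z k)\<bar>) * (B l + \<bar>expectation (Z l)\<bar>)"])
    show "AE \<omega> in M. norm (W k \<omega> * W l \<omega>) \<le> (B k + \<bar>expectation (Z k)\<bar>) * (B l + \<bar>expectation (Z l)\<bar>)"
      using B0 by (auto simp: abs_mult intro!: mult_mono W_bound add_nonneg_nonneg)
  qed simp
  have W_mean: "expectation (W k) = 0" for k
    unfolding W_def using Z_int by (simp add: prob_space)
  have orth: "expectation (\<lambda>\<omega>. W k \<omega> * W l \<omega>) = 0" if "k \<noteq> l" for k l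
  proof -
    have "indep_var borel ((\<lambda>x. x - expectation (Z k)) \<circ> Z k) borel ((\<lambda>x. x - expectation (Z l)) \<circ> Z l)"
      by (rule indep_var_compose[OF indep[OF that]]) auto
    then have "indep_var borel (W k) borel (W l)"
      by (simp add: W_def[abs_def] comp_def)
    then show ?thesis
      by (simp add: indep_var_lebesgue_integral W_int W_mean)
  qed
  have var_le: "expectation (\<lambda>\<omega>. W k \<omega> * W k \<omega>) \<le> expectation (\<lambda>\<omega>. (Z k \<omega>)\<^sup>2)" for k
    using variance_eq[OF Z_int Z2_int, of k] by (simp add: W_def power2_eq_square)
  have sq: "(\<Sum>k\<in>I. W k \<omega>)\<^sup>2 = (\<Sum>k\<in>I. \<Sum>l\<in>I. W k \<omega> * W l \<omega>)" for \<omega>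
    by (simp add: power2_eq_square sum_product)
  have "expectation (\<lambda>\<omega>. (\<Sum>k\<in>I. W k \<omega>)\<^sup>2) = (\<Sum>k\<in>I. \<Sum>l\<in>I. expectation (\<lambda>\<omega>. W k \<omega> * W l \<omega>))"
    unfolding sq using prod_int by (simp add: Bochner_Integration.integral_sum)
  also have "\<dots> = (\<Sum>k\<in>I. expectation (\<lambda>\<omega>. W k \<omega> * W k \<omega>))"
  proof (rule sum.cong[OF refl])
    fix k assume "k \<in> I"
    have "(\<Sum>l\<in>I. expectation (\<lambda>\<omega>. W k \<omega> * W l \<omega>))
        = (\<Sum>l\<in>I. if l = k then expectation (\<lambda>\<omega>. W k \<omega> * W k \<omega>) else 0)"
      by (rule sum.cong) (auto simp: orth)
    then show "(\<Sum>l\<in>I. expectation (\<lambda>\<omega>. W k \<omega> * W l \<omega>)) = expectation (\<lambda>\<omega>. W k \<omega> * W k \<omega>)"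
      using \<open>finite I\<close> \<open>k \<in> I\<close> by simp
  qed
  also have "\<dots> \<le> (\<Sum>k\<in>I. expectation (\<lambda>\<omega>. (Z k \<omega>)\<^sup>2))"
    by (rule sum_mono) (rule var_le)
  finally have le: "expectation (\<lambda>\<omega>. (\<Sum>k\<in>I. W k \<omega>)\<^sup>2) \<le> (\<Sum>k\<in>I. expectation (\<lambda>\<omega>. (Z k \<omega>)\<^sup>2))" .
  have "(\<integral>\<^sup>+\<omega>. ennreal ((\<Sum>k\<in>I. W k \<omega>)\<^sup>2) \<partial>M) = ennreal (expectation (\<lambda>\<omega>. (\<Sum>k\<in>I. W k \<omega>)\<^sup>2))"
  proof (rule nn_integral_eq_integral)
    show "integrable M (\<lambda>\<omega>. (\<Sum>k\<in>I. W k \<omega>)\<^sup>2)"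
      unfolding sq using prod_int by simp
  qed simp
  also have "\<dots> \<le> ennreal (\<Sum>k\<in>I. expectation (\<lambda>\<omega>. (Z k \<omega>)\<^sup>2))"
    using le by (rule ennreal_leI)
  also have "\<dots> = (\<Sum>k\<in>I. \<integral>\<^sup>+\<omega>. ennreal ((Z k \<omega>)\<^sup>2) \<partial>M)"
    by (simp add: nn_integral_eq_integral Z2_int flip: sum_ennreal)
  finally show ?thesis
    by (simp add: W_def)
qed

lemma geometric_bracket:
  fixes q x :: real
  assumes "1 < q" "q ^ i0 \<le> x"
  obtains i where "i0 \<le> i" "q ^ i \<le> x" "x < q ^ Suc i"
proof -
  obtain j0 where j0: "x < q ^ j0"
    using real_arch_pow[OF assms(1), of x] by auto
  define j where "j = (LEAST i. x < q ^ i)"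
  have j: "x < q ^ j"
    unfolding j_def by (rule LeastI[of _ j0]) (use j0 in simp)
  have "i0 < j"
  proof (rule ccontr)
    assume "\<not> i0 < j"
    then have "q ^ j \<le> q ^ i0"
      using assms(1) by (intro power_increasing) auto
    then show False
      using j assms(2) by linarith
  qed
  then obtain i where i: "j = Suc i" "i0 \<le> i"
    by (cases j) auto
  have "\<not> x < q ^ i"
    using not_less_Least[of i "\<lambda>i. x < q ^ i"] i unfolding j_def by auto
  then show ?thesis
    using that i j by auto
qed

text \<open>
  Convergence along \<open>\<lfloor>q ^ i\<rfloor>\<close> extends to all \<open>n\<close> by monotonicity: between two consecutive indices of the
  subsequence, \<open>T n - m n\<close> differs from its values at the endpoints by at most the growth of the
  compensator \<open>m\<close> on that block. The growth is made small by taking \<open>q\<close> close to 1, so \<open>q\<close> is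
  allowed to depend on the precision \<open>\<epsilon>\<close>.
\<close>

lemma average_tendsto_zero_geometric:
  fixes T m :: "nat \<Rightarrow> real"
  assumes "mono T" "mono m"
    and sub: "\<And>\<epsilon>. 0 < \<epsilon> \<Longrightarrow> \<exists>q>1. (\<lambda>i. (T (nat \<lfloor>q ^ i\<rfloor>) - m (nat \<lfloor>q ^ i\<rfloor>)) / q ^ i) \<longlonglongrightarrow> 0 \<and>
      eventually (\<lambda>i. m (nat \<lfloor>q ^ Suc i\<rfloor>) - m (nat \<lfloor>q ^ i\<rfloor>) \<le> \<epsilon> * q ^ i) sequentially"
  shows "(\<lambda>n. (T n - m n) / real n) \<longlonglongrightarrow> 0"
proof (rule LIMSEQ_I)
  fix r :: real assume "0 < r"
  define \<epsilon> where "\<epsilon> = r / 3"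
  have "0 < \<epsilon>" using \<open>0 < r\<close> by (simp add: \<epsilon>_def)
  obtain q where q: "1 < q"
    and lim: "(\<lambda>i. (T (nat \<lfloor>q ^ i\<rfloor>) - m (nat \<lfloor>q ^ i\<rfloor>)) / q ^ i) \<longlonglongrightarrow> 0"
    and growth: "eventually (\<lambda>i. m (nat \<lfloor>q ^ Suc i\<rfloor>) - m (nat \<lfloor>q ^ i\<rfloor>) \<le> \<epsilon> * q ^ i) sequentially"
    using sub[OF \<open>0 < \<epsilon>\<close>] by blast
  define N where "N i = nat \<lfloor>q ^ i\<rfloor>" for i
  have "eventually (\<lambda>i. \<bar>(T (N i) - m (N i)) / q ^ i\<bar> < \<epsilon> / q) sequentially"
    using lim \<open>0 < \<epsilon>\<close> q unfolding N_def by (intro order_tendstoD[OF tendsto_rabs_zero]) auto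
  with growth have "eventually (\<lambda>i. m (N (Suc i)) - m (N i) \<le> \<epsilon> * q ^ i \<and> \<bar>(T (N i) - m (N i)) / q ^ i\<bar> < \<epsilon> / q) sequentially"
    unfolding N_def by eventually_elim auto
  then obtain i0 where i0: "\<And>i. i0 \<le> i \<Longrightarrow> m (N (Suc i)) - m (N i) \<le> \<epsilon> * q ^ i"
      "\<And>i. i0 \<le> i \<Longrightarrow> \<bar>(T (N i) - m (N i)) / q ^ i\<bar> < \<epsilon> / q"
    unfolding eventually_sequentially by blast
  have close: "\<bar>T (N i) - m (N i)\<bar> \<le> \<epsilon> / q * q ^ i" if "i0 \<le> i" for i
    using i0(2)[OF that] q by (simp add: abs_mult field_simps)
  show "\<exists>n0. \<forall>n\<ge>n0. norm ((T n - m n) / real n - 0) < r"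
  proof (intro exI allI impI)
    fix n assume "nat \<lceil>q ^ i0\<rceil> \<le> n"
    then have "q ^ i0 \<le> real n" by linarith
    then obtain i where i: "i0 \<le> i" "q ^ i \<le> real n" "real n < q ^ Suc i"
      using geometric_bracket[OF q] by blast
    have "0 < q ^ i" using q by simp
    have N: "N i \<le> n" "n \<le> N (Suc i)"
      unfolding N_def using i by linarith+
    have 1: "\<bar>T (N i) - m (N i)\<bar> \<le> \<epsilon> * q ^ i"
    proof -
      have "\<epsilon> / q * q ^ i \<le> \<epsilon> * q ^ i"
        using q \<open>0 < \<epsilon>\<close> by (intro mult_right_mono) (auto simp: field_simps)
      then show ?thesis using close[OF i(1)] by linarith
    qed
    have 2: "\<bar>T (N (Suc i)) - m (N (Suc i))\<bar> \<le> \<epsilon> * q ^ i"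
      using close[of "Suc i"] i(1) q by simp
    have "T n - m n \<le> T (N (Suc i)) - m (N i)" "T (N i) - m (N (Suc i)) \<le> T n - m n"
      using monoD[OF \<open>mono T\<close> N(1)] monoD[OF \<open>mono T\<close> N(2)] monoD[OF \<open>mono m\<close> N(1)] monoD[OF \<open>mono m\<close> N(2)]
      by linarith+
    then have "\<bar>T n - m n\<bar> \<le> 2 * \<epsilon> * q ^ i"
      using 1 2 i0(1)[OF i(1)] by linarith
    also have "\<dots> \<le> 2 * \<epsilon> * real n"
      using i(2) \<open>0 < \<epsilon>\<close> by simp
    also have "\<dots> < r * real n"
      using \<open>0 < q ^ i\<close> i(2) \<open>0 < r\<close> by (simp add: \<epsilon>_def)
    finally show "norm ((T n - m n) / real n - 0) < r"
      using \<open>0 < q ^ i\<close> i(2) by (simp add: field_simps)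
  qed
qed

lemma cesaro_zero_if_eventually_zero:
  fixes f :: "nat \<Rightarrow> real"
  assumes "eventually (\<lambda>k. f k = 0) sequentially"
  shows "(\<lambda>n. (\<Sum>k=1..n. f k) / real n) \<longlonglongrightarrow> 0"
proof -
  obtain K where K: "\<And>k. K \<le> k \<Longrightarrow> f k = 0"
    using assms by (auto simp: eventually_sequentially)
  have "eventually (\<lambda>n. (\<Sum>k=1..K. f k) / real n = (\<Sum>k=1..n. f k) / real n) sequentially"
    using eventually_ge_at_top[of K]
  proof eventually_elim
    case (elim n)
    have "(\<Sum>k=1..K. f k) = (\<Sum>k=1..n. f k)"
      by (rule sum.mono_neutral_left) (use elim K in auto)
    then show ?case by simp
  qed
  moreover have "(\<lambda>n. (\<Sum>k=1..K. f k) / real n) \<longlonglongrightarrow> 0"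
    by (rule lim_const_over_n)
  ultimately show ?thesis
    by (rule Lim_transform_eventually[rotated])
qed

lemma delayed_average_tendsto_zero:
  fixes s :: "nat \<Rightarrow> real" and \<psi> :: "nat \<Rightarrow> nat"
  assumes lim: "(\<lambda>m. s m / real m) \<longlonglongrightarrow> 0" and le: "\<And>n. \<psi> n \<le> n"
  shows "(\<lambda>n. s (\<psi> n) / real n) \<longlonglongrightarrow> 0"
proof (rule LIMSEQ_I)
  fix r :: real assume "0 < r"
  then have "eventually (\<lambda>m. \<bar>s m / real m\<bar> < r / 2) sequentially"
    using lim by (intro order_tendstoD[OF tendsto_rabs_zero]) auto
  then obtain N where N: "\<And>m. N \<le> m \<Longrightarrow> \<bar>s m / real m\<bar> < r / 2"
    unfolding eventually_sequentially by blast
  define K where "K = (\<Sum>m\<le>N. \<bar>s m\<bar>)"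
  have bound: "\<bar>s m\<bar> \<le> K + r / 2 * real m" for m
  proof (cases "m \<le> N")
    case True
    then have "\<bar>s m\<bar> \<le> K"
      unfolding K_def by (intro member_le_sum) auto
    then show ?thesis using \<open>0 < r\<close> by (simp add: add_increasing2)
  next
    case False
    then have "\<bar>s m\<bar> \<le> r / 2 * real m"
      using N[of m] by (simp add: abs_divide field_simps)
    moreover have "0 \<le> K"
      unfolding K_def by (rule sum_nonneg) simp
    ultimately show ?thesis by linarith
  qed
  have "(\<lambda>n. K / real n) \<longlonglongrightarrow> 0"
    by (rule lim_const_over_n)
  then have "eventually (\<lambda>n. K / real n < r / 2) sequentially"
    using \<open>0 < r\<close> by (intro order_tendstoD) auto
  then have "eventually (\<lambda>n. norm (s (\<psi> n) / real n - 0) < r) sequentially"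
    using eventually_gt_at_top[of 0]
  proof eventually_elim
    case (elim n)
    have "\<bar>s (\<psi> n)\<bar> \<le> K + r / 2 * real (\<psi> n)"
      by (rule bound)
    also have "\<dots> \<le> K + r / 2 * real n"
      using le[of n] \<open>0 < r\<close> by simp
    also have "\<dots> < r * real n"
      using elim by (simp add: field_simps)
    finally show ?case
      using elim by (simp add: abs_divide field_simps)
  qed
  then show "\<exists>n0. \<forall>n\<ge>n0. norm (s (\<psi> n) / real n - 0) < r"
    by (simp add: eventually_sequentially)
qed

section \<open>Almost sure size of the terms\<close>

context cesaro_dominated
begin

text \<open>
  Besides \<open>U k < k\<close> for all large \<open>k\<close>, summability of the squares also limits how often \<open>U k / k\<close> can be
  close to 1; the powers \<open>(U k / k) powr p\<close> with \<open>p \<ge> 2\<close> are summed by means of it. For \<open>k\<close> between \<open>2 ^ i\<close> and \<open>2 ^ (i + 1)\<close> the ratio is controlled by \<open>min (U k) (2 ^ (i + 1)) / 2 ^ i\<close>, and the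
  sum over the dyadic block is a truncated second moment with \<open>q = 2\<close>.
\<close>

lemma capped_ratio_squares_summable:
  "AE \<omega> in M. summable (\<lambda>k. (min (U k \<omega> / real k) 1)\<^sup>2)"
proof (rule summable_if_nn_suminf_finite)
  define f where "f k = (\<integral>\<^sup>+\<omega>. ennreal ((min (U k \<omega> / real k) 1)\<^sup>2) \<partial>M)" for k
  define s where "s i k = (\<integral>\<^sup>+\<omega>. ennreal ((min (U k \<omega>) (2 ^ i))\<^sup>2) \<partial>M)" for i k :: nat
  define c where "c i = ennreal (4 / (2 ^ i)\<^sup>2)" for i :: nat
  define I where "I i = (\<integral>\<^sup>+t. (ennreal (2 * t) * indicator {0..2 ^ i} t) * H t \<partial>lborel)" for i :: nat
  have weight: "c i * of_nat (2 ^ i) = 4 * ennreal (1 / 2 ^ i)" for i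
  proof -
    have "c i * of_nat (2 ^ i) = ennreal (4 / (2 ^ i)\<^sup>2) * ennreal (real (2 ^ i))"
      by (simp only: c_def ennreal_of_nat_eq_real_of_nat)
    also have "\<dots> = ennreal (4 / (2 ^ i)\<^sup>2 * real (2 ^ i))"
      by (rule ennreal_mult[symmetric]) auto
    also have "4 / (2 ^ i)\<^sup>2 * real (2 ^ i) = 4 * (1 / 2 ^ i)"
      by (simp add: power2_eq_square)
    also have "ennreal (4 * (1 / 2 ^ i)) = 4 * ennreal (1 / 2 ^ i)"
      by (subst ennreal_mult) auto
    finally show ?thesis .
  qed
  have f0: "f 0 = 0" by (simp add: f_def)
  \<comment> \<open>Only the dyadic scale just above \<open>k\<close> is needed, but summing over all larger scales makes
    it possible to exchange the two sums below.\<close>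
  have f_le: "f k \<le> (\<Sum>i. if k \<le> 2 ^ i then c i * s i k else 0)" if "1 \<le> k" for k
  proof -
    obtain i where i: "2 ^ i \<le> real k" "real k < 2 ^ Suc i"
      by (rule geometric_bracket[of 2 0 "real k"]) (use \<open>1 \<le> k\<close> in auto)
    have "k \<le> 2 ^ Suc i"
      using i(2) by (metis less_imp_le of_nat_le_iff of_nat_numeral of_nat_power)
    have "f k \<le> (\<integral>\<^sup>+\<omega>. c (Suc i) * ennreal ((min (U k \<omega>) (2 ^ Suc i))\<^sup>2) \<partial>M)"
      unfolding f_def
    proof (rule nn_integral_mono)
      fix \<omega>
      have "min (U k \<omega> / real k) 1 = min (U k \<omega>) (real k) / real k"
        using that by (auto simp: min_def field_simps)
      also have "\<dots> \<le> min (U k \<omega>) (2 ^ Suc i) / 2 ^ i"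
        using i nonneg[of k \<omega>] by (intro frac_le) auto
      finally have "(min (U k \<omega> / real k) 1)\<^sup>2 \<le> (min (U k \<omega>) (2 ^ Suc i) / 2 ^ i)\<^sup>2"
        using nonneg[of k \<omega>] by (intro power_mono) auto
      also have "\<dots> = 4 / (2 ^ Suc i)\<^sup>2 * (min (U k \<omega>) (2 ^ Suc i))\<^sup>2"
        by (simp add: power_divide power_mult_distrib)
      finally show "ennreal ((min (U k \<omega> / real k) 1)\<^sup>2) \<le> c (Suc i) * ennreal ((min (U k \<omega>) (2 ^ Suc i))\<^sup>2)"
        unfolding c_def by (subst ennreal_mult[symmetric]) (auto intro: ennreal_leI)
    qed
    also have "\<dots> = (if k \<le> 2 ^ Suc i then c (Suc i) * s (Suc i) k else 0)"
      unfolding s_def using \<open>k \<le> 2 ^ Suc i\<close> by (simp add: nn_integral_cmult)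
    also have "\<dots> \<le> (\<Sum>i. if k \<le> 2 ^ i then c i * s i k else 0)"
      using sum_le_suminf[of "\<lambda>i. if k \<le> 2 ^ i then c i * s i k else 0" "{Suc i}"] by simp
    finally show ?thesis .
  qed
  have partial: "(\<Sum>k=1..n. f k) \<le> (\<Sum>i. 4 * (ennreal (1 / 2 ^ i) * I i))" for n
  proof -
    have "(\<Sum>k=1..n. f k) \<le> (\<Sum>k=1..n. \<Sum>i. if k \<le> 2 ^ i then c i * s i k else 0)"
      by (rule sum_mono) (simp add: f_le)
    also have "\<dots> = (\<Sum>i. \<Sum>k=1..n. if k \<le> 2 ^ i then c i * s i k else 0)"
      by (rule suminf_sum[symmetric]) simp
    also have "\<dots> \<le> (\<Sum>i. 4 * (ennreal (1 / 2 ^ i) * I i))"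
    proof (rule suminf_le)
      fix i
      have "(\<Sum>k=1..n. if k \<le> 2 ^ i then c i * s i k else 0) = (\<Sum>k\<in>{k\<in>{1..n}. k \<le> 2 ^ i}. c i * s i k)"
        by (rule sum.inter_filter[symmetric]) simp
      also have "\<dots> \<le> (\<Sum>k=1..2 ^ i. c i * s i k)"
        by (rule sum_mono2) auto
      also have "\<dots> = c i * (\<Sum>k=1..2 ^ i. s i k)"
        by (simp add: sum_distrib_left)
      also have "\<dots> \<le> c i * (of_nat (2 ^ i) * I i)"
        unfolding s_def I_def by (intro mult_left_mono sum_truncated_second_moments) auto
      finally show "(\<Sum>k=1..n. if k \<le> 2 ^ i then c i * s i k else 0) \<le> 4 * (ennreal (1 / 2 ^ i) * I i)"
        by (simp only: mult.assoc[symmetric] weight)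
    qed auto
    finally show ?thesis .
  qed
  have "(\<Sum>k. f k) \<le> (\<Sum>i. 4 * (ennreal (1 / 2 ^ i) * I i))"
  proof (rule suminf_le_const)
    fix n
    have "(\<Sum>k<n. f k) \<le> (\<Sum>k=0..n. f k)"
      by (rule sum_mono2) auto
    also have "\<dots> = (\<Sum>k=1..n. f k)"
      by (simp add: sum.atLeast_Suc_atMost f0)
    finally show "(\<Sum>k<n. f k) \<le> (\<Sum>i. 4 * (ennreal (1 / 2 ^ i) * I i))"
      using partial[of n] by order
  qed simp
  also have "\<dots> < \<infinity>"
    using geometric_second_moments_finite[of 2] by (simp add: I_def ennreal_mult_less_top)
  finally show "(\<Sum>k. \<integral>\<^sup>+\<omega>. ennreal ((min (U k \<omega> / real k) 1)\<^sup>2) \<partial>M) < \<infinity>"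
    by (simp add: f_def)
qed auto

lemma eventually_below_index:
  "AE \<omega> in M. eventually (\<lambda>k. U k \<omega> < real k) sequentially"
  using capped_ratio_squares_summable
proof eventually_elim
  case (elim \<omega>)
  have "eventually (\<lambda>k. (min (U k \<omega> / real k) 1)\<^sup>2 < 1) sequentially"
    using summable_LIMSEQ_zero[OF elim] by (rule order_tendstoD) simp
  then show ?case
    using eventually_gt_at_top[of 0]
  proof eventually_elim
    case (elim k)
    show ?case
    proof (rule ccontr)
      assume "\<not> U k \<omega> < real k"
      then have "min (U k \<omega> / real k) 1 = 1"
        using elim by (simp add: min_def field_simps)
      then show False using elim by simp
    qed
  qed
qed

end

section \<open>A strong law for nonnegative pairwise independent variables\<close>

text \<open>
  The setting of Etemadi's strong law, with identical distribution replaced by dominated Cesaro tails.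
\<close>

locale pairwise_indep_dominated = cesaro_dominated +
  assumes integrable_U: "\<And>k. integrable M (U k)"
    and pairwise_indep: "\<And>k l. k \<noteq> l \<Longrightarrow> indep_var borel (U k) borel (U l)"
begin

definition trunc :: "nat \<Rightarrow> 'a \<Rightarrow> real" where
  "trunc k \<omega> = min (U k \<omega>) (real k)"

lemma trunc_measurable [measurable]: "trunc k \<in> borel_measurable M"
  unfolding trunc_def[abs_def] by measurable

lemma trunc_nonneg: "0 \<le> trunc k \<omega>"
  by (simp add: trunc_def nonneg)

lemma integrable_min: "0 \<le> c \<Longrightarrow> integrable M (\<lambda>\<omega>. min (U k \<omega>) c)"
  by (rule integrable_const_bound[where B = c]) (auto simp: nonneg)

lemma integrable_trunc: "integrable M (trunc k)"
  unfolding trunc_def[abs_def] by (rule integrable_min) simp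

lemma sum_excess_expectation:
  assumes "0 \<le> c" "0 \<le> \<delta>" and \<delta>: "(\<integral>\<^sup>+t. indicator {c..} t * H t \<partial>lborel) \<le> ennreal \<delta>"
  shows "(\<Sum>k=1..n. expectation (\<lambda>\<omega>. U k \<omega> - min (U k \<omega>) c)) \<le> real n * \<delta>"
proof -
  have int: "integrable M (\<lambda>\<omega>. U k \<omega> - min (U k \<omega>) c)" for k
    using integrable_U integrable_min[OF \<open>0 \<le> c\<close>] by simp
  have "ennreal (\<Sum>k=1..n. expectation (\<lambda>\<omega>. U k \<omega> - min (U k \<omega>) c))
      = (\<Sum>k=1..n. \<integral>\<^sup>+\<omega>. ennreal (U k \<omega> - min (U k \<omega>) c) \<partial>M)"
    using int by (simp add: nn_integral_eq_integral flip: sum_ennreal)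
  also have "\<dots> \<le> of_nat n * ennreal \<delta>"
    by (rule order_trans[OF sum_excess_means[OF \<open>0 \<le> c\<close>] mult_left_mono[OF \<delta>]]) simp
  also have "\<dots> = ennreal (real n * \<delta>)"
    using \<open>0 \<le> \<delta>\<close> by (simp add: ennreal_of_nat_eq_real_of_nat ennreal_mult)
  finally show ?thesis
    using \<open>0 \<le> \<delta>\<close> by (subst (asm) ennreal_le_iff) auto
qed

text \<open>
  The means of the individual terms can be unbounded, so a short block is not obviously a small part of
  the compensator. Splitting each variable at a level \<open>c\<close> gives at most \<open>c\<close> per term plus an excess that is small on average. This is the growth condition in
  \<open>average_tendsto_zero_geometric\<close> once \<open>c\<close> is fixed and \<open>q\<close> is taken close to 1.
\<close>

lemma trunc_expectation_growth:
  assumes "0 < \<epsilon>"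
  shows "\<exists>c\<ge>0. \<forall>l n. l \<le> n \<longrightarrow>
    (\<Sum>k=1..n. expectation (trunc k)) - (\<Sum>k=1..l. expectation (trunc k)) \<le> c * (real n - real l) + \<epsilon> * real n"
proof -
  obtain c where c: "0 \<le> c" "(\<integral>\<^sup>+t. indicator {c..} t * H t \<partial>lborel) \<le> ennreal \<epsilon>"
    using excess_vanishes[OF assms] by blast
  have le: "expectation (trunc k) \<le> c + expectation (\<lambda>\<omega>. U k \<omega> - min (U k \<omega>) c)" for k
  proof -
    have "expectation (trunc k) \<le> expectation (\<lambda>\<omega>. c + (U k \<omega> - min (U k \<omega>) c))"
      by (rule integral_mono) (auto simp: integrable_trunc integrable_U integrable_min c(1) trunc_def)
    also have "\<dots> = c + expectation (\<lambda>\<omega>. U k \<omega> - min (U k \<omega>) c)"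
      using integrable_U integrable_min[OF c(1)] by (simp add: prob_space)
    finally show ?thesis .
  qed
  have excess_nonneg: "0 \<le> expectation (\<lambda>\<omega>. U k \<omega> - min (U k \<omega>) c)" for k
    by (rule integral_nonneg_AE) simp
  have "(\<Sum>k=1..n. expectation (trunc k)) - (\<Sum>k=1..l. expectation (trunc k)) \<le> c * (real n - real l) + \<epsilon> * real n"
    if "l \<le> n" for l n
  proof -
    have split: "{1..n} = {1..l} \<union> {l+1..n}" "{1..l} \<inter> {l+1..n} = {}"
      using that by auto
    have "(\<Sum>k=1..n. expectation (trunc k)) - (\<Sum>k=1..l. expectation (trunc k)) = (\<Sum>k=l+1..n. expectation (trunc k))"
      unfolding split(1) using split(2) by (subst sum.union_disjoint) auto
    also have "\<dots> \<le> (\<Sum>k=l+1..n. c + expectation (\<lambda>\<omega>. U k \<omega> - min (U k \<omega>) c))"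
      by (rule sum_mono) (rule le)
    also have "\<dots> = c * (real n - real l) + (\<Sum>k=l+1..n. expectation (\<lambda>\<omega>. U k \<omega> - min (U k \<omega>) c))"
      using that by (simp add: sum.distrib of_nat_diff)
    also have "(\<Sum>k=l+1..n. expectation (\<lambda>\<omega>. U k \<omega> - min (U k \<omega>) c))
        \<le> (\<Sum>k=1..n. expectation (\<lambda>\<omega>. U k \<omega> - min (U k \<omega>) c))"
      by (rule sum_mono2) (auto simp: excess_nonneg)
    also have "\<dots> \<le> real n * \<epsilon>"
      using assms by (intro sum_excess_expectation c) auto
    finally show ?thesis by (simp add: mult.commute)
  qed
  with c(1) show ?thesis by blast
qed

text \<open>
  All truncation levels \<open>k \<le> q ^ i\<close> are raised to \<open>q ^ i\<close>, so the variances of the centred sums, divided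
  by \<open>(q ^ i)\<^sup>2\<close>, are summable by \<open>geometric_second_moments_finite\<close>.
\<close>

lemma trunc_geometric_subsequence:
  assumes "1 < q"
  shows "AE \<omega> in M. (\<lambda>i. ((\<Sum>k=1..nat \<lfloor>q ^ i\<rfloor>. trunc k \<omega>) - (\<Sum>k=1..nat \<lfloor>q ^ i\<rfloor>. expectation (trunc k))) / q ^ i) \<longlonglongrightarrow> 0"
proof -
  define N where "N i = nat \<lfloor>q ^ i\<rfloor>" for i
  define D where "D i \<omega> = (\<Sum>k=1..N i. trunc k \<omega> - expectation (trunc k))" for i \<omega>
  define I where "I i = (\<integral>\<^sup>+t. (ennreal (2 * t) * indicator {0..q ^ i} t) * H t \<partial>lborel)" for i
  have [measurable]: "D i \<in> borel_measurable M" for i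
    unfolding D_def[abs_def] by measurable
  have q_pos: "0 < q ^ i" for i
    using assms by simp
  have N_le: "real (N i) \<le> q ^ i" for i
    unfolding N_def using q_pos[of i] by linarith
  have indep: "indep_var borel (trunc k) borel (trunc l)" if "k \<noteq> l" for k l
  proof -
    have "indep_var borel ((\<lambda>x. min x (real k)) \<circ> U k) borel ((\<lambda>x. min x (real l)) \<circ> U l)"
      by (rule indep_var_compose[OF pairwise_indep[OF that]]) auto
    then show ?thesis
      by (simp add: trunc_def[abs_def] comp_def)
  qed
  have "AE \<omega> in M. summable (\<lambda>i. (D i \<omega> / q ^ i)\<^sup>2)"
  proof (rule summable_if_nn_suminf_finite)
    have "(\<integral>\<^sup>+\<omega>. ennreal ((D i \<omega> / q ^ i)\<^sup>2) \<partial>M) \<le> ennreal (1 / q ^ i) * I i" for i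
    proof -
      have "(\<integral>\<^sup>+\<omega>. ennreal ((D i \<omega>)\<^sup>2) \<partial>M) \<le> (\<Sum>k=1..N i. \<integral>\<^sup>+\<omega>. ennreal ((trunc k \<omega>)\<^sup>2) \<partial>M)"
        unfolding D_def
        by (rule second_moment_sum_pairwise_indep[where B = real])
          (auto simp: indep trunc_nonneg, auto simp: trunc_def)
      also have "\<dots> \<le> (\<Sum>k=1..N i. \<integral>\<^sup>+\<omega>. ennreal ((min (U k \<omega>) (q ^ i))\<^sup>2) \<partial>M)"
      proof (intro sum_mono nn_integral_mono ennreal_leI power_mono)
        fix k \<omega> assume "k \<in> {1..N i}"
        then have "real k \<le> q ^ i"
          using N_le[of i] by (simp add: order_trans[OF of_nat_mono])
        then show "trunc k \<omega> \<le> min (U k \<omega>) (q ^ i)"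
          by (simp add: trunc_def)
      qed (rule trunc_nonneg)
      also have "\<dots> \<le> of_nat (N i) * I i"
        unfolding I_def using q_pos[of i] by (intro sum_truncated_second_moments) simp
      also have "\<dots> \<le> ennreal (q ^ i) * I i"
        using N_le[of i] by (intro mult_right_mono) (auto simp: ennreal_of_nat_eq_real_of_nat intro: ennreal_leI)
      finally have le: "(\<integral>\<^sup>+\<omega>. ennreal ((D i \<omega>)\<^sup>2) \<partial>M) \<le> ennreal (q ^ i) * I i" .
      have "(\<integral>\<^sup>+\<omega>. ennreal ((D i \<omega> / q ^ i)\<^sup>2) \<partial>M) = (\<integral>\<^sup>+\<omega>. ennreal (1 / (q ^ i)\<^sup>2) * ennreal ((D i \<omega>)\<^sup>2) \<partial>M)"
        by (simp add: power_divide flip: ennreal_mult)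
      also have "\<dots> = ennreal (1 / (q ^ i)\<^sup>2) * (\<integral>\<^sup>+\<omega>. ennreal ((D i \<omega>)\<^sup>2) \<partial>M)"
        by (rule nn_integral_cmult) measurable
      also have "\<dots> \<le> ennreal (1 / (q ^ i)\<^sup>2) * (ennreal (q ^ i) * I i)"
        by (intro mult_left_mono le) simp
      also have "\<dots> = ennreal (1 / q ^ i) * I i"
        using q_pos[of i] by (simp add: power2_eq_square flip: ennreal_mult mult.assoc)
      finally show ?thesis .
    qed
    then have "(\<Sum>i. \<integral>\<^sup>+\<omega>. ennreal ((D i \<omega> / q ^ i)\<^sup>2) \<partial>M) \<le> (\<Sum>i. ennreal (1 / q ^ i) * I i)"
      by (rule suminf_le) auto
    also have "\<dots> < \<infinity>"
      unfolding I_def by (rule geometric_second_moments_finite[OF assms])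
    finally show "(\<Sum>i. \<integral>\<^sup>+\<omega>. ennreal ((D i \<omega> / q ^ i)\<^sup>2) \<partial>M) < \<infinity>" .
  qed auto
  then show ?thesis
  proof eventually_elim
    case (elim \<omega>)
    have "(\<lambda>i. (D i \<omega> / q ^ i)\<^sup>2) \<longlonglongrightarrow> 0"
      by (rule summable_LIMSEQ_zero[OF elim])
    then have "(\<lambda>i. D i \<omega> / q ^ i) \<longlonglongrightarrow> 0"
      by (simp add: power_tendsto_0_iff)
    then show ?case
      by (simp add: D_def N_def sum_subtractf)
  qed
qed

lemma trunc_slln:
  "AE \<omega> in M. (\<lambda>n. ((\<Sum>k=1..n. trunc k \<omega>) - (\<Sum>k=1..n. expectation (trunc k))) / real n) \<longlonglongrightarrow> 0"
proof -
  define m where "m n = (\<Sum>k=1..n. expectation (trunc k))" for n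
  have expectation_nonneg: "0 \<le> expectation (trunc k)" for k
    by (rule integral_nonneg_AE) (simp add: trunc_nonneg)
  \<comment> \<open>Countably many ratios tending to 1 suffice, so the exceptional null sets can be united.\<close>
  have "AE \<omega> in M. \<forall>j. (\<lambda>i. ((\<Sum>k=1..nat \<lfloor>(1 + 1 / real (Suc j)) ^ i\<rfloor>. trunc k \<omega>)
      - m (nat \<lfloor>(1 + 1 / real (Suc j)) ^ i\<rfloor>)) / (1 + 1 / real (Suc j)) ^ i) \<longlonglongrightarrow> 0"
    unfolding AE_all_countable m_def by (intro allI trunc_geometric_subsequence) simp
  then have "AE \<omega> in M. (\<lambda>n. ((\<Sum>k=1..n. trunc k \<omega>) - m n) / real n) \<longlonglongrightarrow> 0"
  proof eventually_elim
    case (elim \<omega>)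
    show ?case
    proof (rule average_tendsto_zero_geometric)
      show "mono (\<lambda>n. \<Sum>k=1..n. trunc k \<omega>)"
        by (intro monoI sum_mono2) (auto simp: trunc_nonneg)
      show "mono m"
        unfolding m_def by (intro monoI sum_mono2) (auto simp: expectation_nonneg)
      fix \<epsilon> :: real assume "0 < \<epsilon>"
      then obtain c where c: "0 \<le> c"
        "\<And>l n. l \<le> n \<Longrightarrow> m n - m l \<le> c * (real n - real l) + \<epsilon> / 8 * real n"
        using trunc_expectation_growth[of "\<epsilon> / 8"] unfolding m_def by auto
      \<comment> \<open>The level \<open>c\<close> is fixed first; then \<open>q - 1 = 1 / (j + 1)\<close> is made small compared with \<open>\<epsilon> / c\<close>.\<close>
      obtain j :: nat where j: "4 * c / \<epsilon> < real (Suc j)"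
        by (metis reals_Archimedean2 less_trans lessI of_nat_less_iff)
      define q where "q = 1 + 1 / real (Suc j)"
      have q: "1 < q" "q \<le> 2" and cq: "c * (q - 1) \<le> \<epsilon> / 4"
        using j \<open>0 < \<epsilon>\<close> by (auto simp: q_def field_simps)
      have "(\<lambda>i. c * (1 / q) ^ i) \<longlonglongrightarrow> c * 0"
        using q by (intro tendsto_mult_left LIMSEQ_realpow_zero) auto
      then have "eventually (\<lambda>i. c * (1 / q) ^ i < \<epsilon> / 4) sequentially"
        using \<open>0 < \<epsilon>\<close> by (intro order_tendstoD) auto
      then have "eventually (\<lambda>i. m (nat \<lfloor>q ^ Suc i\<rfloor>) - m (nat \<lfloor>q ^ i\<rfloor>) \<le> \<epsilon> * q ^ i) sequentially"
      proof eventually_elim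
        case (elim i)
        have pos: "0 < q ^ i" using q by simp
        have le: "q ^ i \<le> q ^ Suc i" using q by simp
        then have ord: "nat \<lfloor>q ^ i\<rfloor> \<le> nat \<lfloor>q ^ Suc i\<rfloor>"
          by (intro nat_mono floor_mono)
        \<comment> \<open>The floors cost at most 1 in the length of the block, hence the extra \<open>c\<close> below, which is
          eventually negligible against \<open>q ^ i\<close>.\<close>
        have up: "real (nat \<lfloor>q ^ Suc i\<rfloor>) \<le> q * q ^ i" and low: "q ^ i - 1 \<le> real (nat \<lfloor>q ^ i\<rfloor>)"
          using pos le unfolding power_Suc by linarith+
        have "m (nat \<lfloor>q ^ Suc i\<rfloor>) - m (nat \<lfloor>q ^ i\<rfloor>)
            \<le> c * (real (nat \<lfloor>q ^ Suc i\<rfloor>) - real (nat \<lfloor>q ^ i\<rfloor>)) + \<epsilon> / 8 * real (nat \<lfloor>q ^ Suc i\<rfloor>)"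
          by (rule c(2)[OF ord])
        also have "\<dots> \<le> c * (q * q ^ i - (q ^ i - 1)) + \<epsilon> / 8 * (2 * q ^ i)"
        proof (intro add_mono mult_left_mono diff_mono up low)
          show "real (nat \<lfloor>q ^ Suc i\<rfloor>) \<le> 2 * q ^ i"
            using up q(2) pos by (meson mult_right_mono less_imp_le order_trans)
        qed (use c(1) \<open>0 < \<epsilon>\<close> in auto)
        also have "\<dots> = (c * (q - 1)) * q ^ i + c + \<epsilon> / 4 * q ^ i"
          by (simp add: algebra_simps)
        also have "\<dots> \<le> \<epsilon> / 4 * q ^ i + \<epsilon> / 4 * q ^ i + \<epsilon> / 4 * q ^ i"
        proof (intro add_mono mult_right_mono cq)
          show "c \<le> \<epsilon> / 4 * q ^ i"
            using elim pos by (simp add: power_divide field_simps)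
        qed (use pos in auto)
        also have "\<dots> \<le> \<epsilon> * q ^ i"
          using pos \<open>0 < \<epsilon>\<close> by simp
        finally show ?case .
      qed
      moreover have "(\<lambda>i. ((\<Sum>k=1..nat \<lfloor>q ^ i\<rfloor>. trunc k \<omega>) - m (nat \<lfloor>q ^ i\<rfloor>)) / q ^ i) \<longlonglongrightarrow> 0"
        using elim unfolding q_def by blast
      ultimately show "\<exists>q>1. (\<lambda>i. ((\<Sum>k=1..nat \<lfloor>q ^ i\<rfloor>. trunc k \<omega>) - m (nat \<lfloor>q ^ i\<rfloor>)) / q ^ i) \<longlonglongrightarrow> 0 \<and>
          eventually (\<lambda>i. m (nat \<lfloor>q ^ Suc i\<rfloor>) - m (nat \<lfloor>q ^ i\<rfloor>) \<le> \<epsilon> * q ^ i) sequentially"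
        using q(1) by blast
    qed
  qed
  then show ?thesis
    by (simp add: m_def)
qed

text \<open>
  For \<open>k \<ge> c\<close> the truncation at \<open>k\<close> removes at most what the truncation at \<open>c\<close> removes; the finitely many other
  indices do not affect the limit.
\<close>

lemma truncation_bias_cesaro:
  "(\<lambda>n. (\<Sum>k=1..n. expectation (U k) - expectation (trunc k)) / real n) \<longlonglongrightarrow> 0"
proof (rule LIMSEQ_I)
  fix r :: real assume "0 < r"
  obtain c where c: "0 \<le> c" "(\<integral>\<^sup>+t. indicator {c..} t * H t \<partial>lborel) \<le> ennreal (r / 2)"
    using excess_vanishes[of "r / 2"] \<open>0 < r\<close> by auto
  define b where "b k = expectation (U k) - expectation (trunc k)" for k
  define e where "e k = expectation (\<lambda>\<omega>. U k \<omega> - min (U k \<omega>) c)" for k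
  have b_nonneg: "0 \<le> b k" for k
    unfolding b_def using integral_mono[OF integrable_trunc integrable_U, of k k] by (simp add: trunc_def)
  have e_nonneg: "0 \<le> e k" for k
    unfolding e_def by (rule integral_nonneg_AE) simp
  have b_le: "b k \<le> e k" if "c \<le> real k" for k
  proof -
    have "expectation (\<lambda>\<omega>. min (U k \<omega>) c) \<le> expectation (trunc k)"
      using that by (intro integral_mono integrable_min c(1) integrable_trunc) (simp add: trunc_def)
    then show ?thesis
      unfolding b_def e_def using integrable_U integrable_min[OF c(1)] by simp
  qed
  define f where "f k = (if c \<le> real k then 0 else b k)" for k
  have "eventually (\<lambda>k. c \<le> real k) sequentially"
    using filterlim_real_sequentially by (auto simp: filterlim_at_top)
  then have "eventually (\<lambda>k. f k = 0) sequentially"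
    by eventually_elim (simp add: f_def)
  then have "(\<lambda>n. (\<Sum>k=1..n. f k) / real n) \<longlonglongrightarrow> 0"
    by (rule cesaro_zero_if_eventually_zero)
  then have "eventually (\<lambda>n. (\<Sum>k=1..n. f k) / real n < r / 2) sequentially"
    using \<open>0 < r\<close> by (intro order_tendstoD) auto
  then have "eventually (\<lambda>n. norm ((\<Sum>k=1..n. b k) / real n - 0) < r) sequentially"
    using eventually_gt_at_top[of 0]
  proof eventually_elim
    case (elim n)
    have "(\<Sum>k=1..n. b k) \<le> (\<Sum>k=1..n. f k + e k)"
      by (rule sum_mono) (auto simp: f_def b_le e_nonneg)
    also have "\<dots> \<le> (\<Sum>k=1..n. f k) + real n * (r / 2)"
      unfolding e_def sum.distrib using \<open>0 < r\<close> by (intro add_left_mono sum_excess_expectation c) auto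
    also have "\<dots> < real n * r"
      using elim by (simp add: field_simps)
    finally have "(\<Sum>k=1..n. b k) < real n * r" .
    moreover have "0 \<le> (\<Sum>k=1..n. b k)"
      by (rule sum_nonneg) (rule b_nonneg)
    ultimately show ?case
      using elim by (simp add: field_simps)
  qed
  then show "\<exists>n0. \<forall>n\<ge>n0. norm ((\<Sum>k=1..n. expectation (U k) - expectation (trunc k)) / real n - 0) < r"
    by (simp add: eventually_sequentially b_def)
qed

text \<open>
  Almost surely only finitely many truncations are active, and they shift the averaged means by a
  vanishing amount, so the law for the truncated variables transfers.
\<close>

lemma pairwise_indep_slln:
  "AE \<omega> in M. (\<lambda>n. (\<Sum>k=1..n. U k \<omega> - expectation (U k)) / real n) \<longlonglongrightarrow> 0"
  using trunc_slln eventually_below_index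
proof eventually_elim
  case (elim \<omega>)
  have "(\<lambda>n. (\<Sum>k=1..n. U k \<omega> - trunc k \<omega>) / real n) \<longlonglongrightarrow> 0"
    using elim(2) by (intro cesaro_zero_if_eventually_zero) (auto elim!: eventually_mono simp: trunc_def)
  from tendsto_diff[OF tendsto_add[OF elim(1) this] truncation_bias_cesaro]
  show ?case
    by (simp add: sum_subtractf diff_divide_distrib)
qed

end

section \<open>Pairwise independent centred variables\<close>

text \<open>
  Positive and negative parts inherit pairwise independence and are dominated by the same averaged
  tails, and their means cancel. Terms before \<open>n0\<close> are replaced by 0: the tail condition says nothing
  about them, and they do not influence the limit.
\<close>

lemma (in prob_space) centred_pairwise_indep_slln:
  fixes X :: "nat \<Rightarrow> 'a \<Rightarrow> real" and n0 :: nat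
  assumes X_rv: "\<And>n. n \<ge> 1 \<Longrightarrow> X n \<in> borel_measurable M"
    and X_indep: "\<And>m n. 1 \<le> m \<Longrightarrow> 1 \<le> n \<Longrightarrow> m \<noteq> n \<Longrightarrow> indep_var borel (X m) borel (X n)"
    and X_integrable: "\<And>n. n \<ge> 1 \<Longrightarrow> integrable M (X n)"
    and X_mean: "\<And>n. n \<ge> 1 \<Longrightarrow> expectation (X n) = 0"
    and n0: "n0 \<ge> 1"
    and X_tail: "(\<integral>\<^sup>+x\<in>{0..}. (SUP n\<in>{n0..}. ennreal
          (1 / real n * (\<Sum>k=n0..n. prob {\<omega>\<in>space M. \<bar>X k \<omega>\<bar> > x}))) \<partial>lborel) < \<infinity>"
  shows "AE \<omega> in M. (\<lambda>n. (\<Sum>k=1..n. X k \<omega>) / real n) \<longlonglongrightarrow> 0"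
proof -
  define H where "H x = (SUP n\<in>{n0..}. ennreal
          (1 / real n * (\<Sum>k=n0..n. prob {\<omega>\<in>space M. \<bar>X k \<omega>\<bar> > x})))" for x
  \<comment> \<open>\<open>R f\<close> with \<open>f\<close> the positive or the negative part is the sequence to which the law applies.\<close>
  define R where "R f k \<omega> = (if k < n0 then 0 else f (X k \<omega>))" for f :: "real \<Rightarrow> real" and k \<omega>
  have [measurable]: "(\<lambda>x. prob {\<omega>\<in>space M. x < \<bar>X k \<omega>\<bar>}) \<in> borel_measurable borel" if "1 \<le> k" for k
  proof -
    note [measurable] = X_rv[OF that]
    show ?thesis unfolding measure_def by measurable
  qed
  have H_meas: "H \<in> borel_measurable borel"
    unfolding H_def[abs_def]
  proof (rule borel_measurable_SUP)
    fix n
    show "(\<lambda>x. ennreal (1 / real n * (\<Sum>k=n0..n. prob {\<omega>\<in>space M. \<bar>X k \<omega>\<bar> > x}))) \<in> borel_measurable borel"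
      using n0 by (intro measurable_compose[OF _ measurable_ennreal] borel_measurable_times borel_measurable_sum
          borel_measurable_const) auto
  qed simp
  have slln: "AE \<omega> in M. (\<lambda>n. (\<Sum>k=1..n. R f k \<omega> - expectation (R f k)) / real n) \<longlonglongrightarrow> 0"
    if f_meas [measurable]: "f \<in> borel_measurable borel" and f: "\<And>x. 0 \<le> f x" "\<And>x. f x \<le> \<bar>x\<bar>" for f
  proof -
    have f0: "f 0 = 0" using f[of 0] by simp
    have R_meas: "R f k \<in> borel_measurable M" for k
    proof (cases "k < n0")
      case False
      then have [measurable]: "X k \<in> borel_measurable M" using n0 by (intro X_rv) simp
      show ?thesis using False by (simp add: R_def[abs_def])
    qed (simp add: R_def[abs_def])
    have "pairwise_indep_dominated M (R f) H"
    proof (unfold_locales; (rule R_meas H_meas)?)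
      show "0 \<le> R f k \<omega>" for k \<omega>
        by (simp add: R_def f)
      show "(\<integral>\<^sup>+t. H t * indicator {0..} t \<partial>lborel) < \<infinity>"
        using X_tail by (simp add: H_def)
      show "integrable M (R f k)" for k
      proof (cases "k < n0")
        case False
        then have "integrable M (\<lambda>\<omega>. \<bar>X k \<omega>\<bar>)"
          using n0 by (intro integrable_abs X_integrable) simp
        then show ?thesis
          by (rule Bochner_Integration.integrable_bound[OF _ R_meas]) (auto simp: R_def f)
      qed (simp add: R_def[abs_def])
      show "indep_var borel (R f k) borel (R f l)" if "k \<noteq> l" for k l
      proof -
        \<comment> \<open>At index 0 the sequence \<open>R f\<close> is the constant 0, a function of any variable; \<open>X 0\<close> itself need
          not be measurable, so another index, distinct from the one on the other side, represents it.\<close>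
        define k' l' where "k' = (if k = 0 then Suc l else k)" and "l' = (if l = 0 then Suc k else l)"
        have "indep_var borel (X k') borel (X l')"
          by (rule X_indep) (use that in \<open>auto simp: k'_def l'_def\<close>)
        then have "indep_var borel ((\<lambda>x. if k < n0 then 0 else f x) \<circ> X k') borel ((\<lambda>x. if l < n0 then 0 else f x) \<circ> X l')"
          by (rule indep_var_compose) auto
        also have "(\<lambda>x. if k < n0 then 0 else f x) \<circ> X k' = R f k"
          using n0 by (auto simp: R_def fun_eq_iff k'_def)
        also have "(\<lambda>x. if l < n0 then 0 else f x) \<circ> X l' = R f l"
          using n0 by (auto simp: R_def fun_eq_iff l'_def)
        finally show ?thesis .
      qed
      show "(\<Sum>k=1..n. emeasure M {\<omega>\<in>space M. t < R f k \<omega>}) \<le> of_nat n * H t" if "0 \<le> t" for n t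
      proof (cases "n < n0")
        case True
        then have "(\<Sum>k=1..n. emeasure M {\<omega>\<in>space M. t < R f k \<omega>}) = 0"
          using that by (intro sum.neutral) (auto simp: R_def)
        then show ?thesis by simp
      next
        case False
        define S where "S = (\<Sum>k=n0..n. prob {\<omega>\<in>space M. \<bar>X k \<omega>\<bar> > t})"
        have "(\<Sum>k=1..n. emeasure M {\<omega>\<in>space M. t < R f k \<omega>}) = (\<Sum>k=n0..n. emeasure M {\<omega>\<in>space M. t < R f k \<omega>})"
          by (rule sum.mono_neutral_right) (use n0 that in \<open>auto simp: R_def\<close>)
        also have "\<dots> \<le> (\<Sum>k=n0..n. emeasure M {\<omega>\<in>space M. \<bar>X k \<omega>\<bar> > t})"
        proof (rule sum_mono)
          fix k assume k: "k \<in> {n0..n}"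
          then have [measurable]: "X k \<in> borel_measurable M"
            using n0 by (intro X_rv) simp
          show "emeasure M {\<omega>\<in>space M. t < R f k \<omega>} \<le> emeasure M {\<omega>\<in>space M. \<bar>X k \<omega>\<bar> > t}"
            by (rule emeasure_mono) (use k f(2) in \<open>auto simp: R_def intro: less_le_trans\<close>)
        qed
        also have "\<dots> = ennreal S"
          by (simp add: S_def emeasure_eq_measure)
        also have "\<dots> = of_nat n * ennreal (1 / real n * S)"
          using False n0 by (simp add: ennreal_of_nat_eq_real_of_nat S_def sum_nonneg flip: ennreal_mult)
        also have "\<dots> \<le> of_nat n * H t"
          unfolding H_def S_def using False by (intro mult_left_mono SUP_upper) auto
        finally show ?thesis .
      qed
    qed
    then show ?thesis
      by (rule pairwise_indep_dominated.pairwise_indep_slln)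
  qed
  have mean: "expectation (R (max 0) k) = expectation (R (\<lambda>x. max 0 (- x)) k)" for k
  proof (cases "k < n0")
    case False
    then have k: "1 \<le> k" using n0 by simp
    have "expectation (\<lambda>\<omega>. max 0 (X k \<omega>)) - expectation (\<lambda>\<omega>. max 0 (- X k \<omega>))
        = expectation (\<lambda>\<omega>. max 0 (X k \<omega>) - max 0 (- X k \<omega>))"
      using X_integrable[OF k] by (intro Bochner_Integration.integral_diff[symmetric]) auto
    also have "(\<lambda>\<omega>. max 0 (X k \<omega>) - max 0 (- X k \<omega>)) = X k"
      by (auto simp: max_def)
    finally show ?thesis
      using False by (simp add: R_def[abs_def] X_mean[OF k])
  qed (simp add: R_def[abs_def])
  have "AE \<omega> in M. (\<lambda>n. (\<Sum>k=1..n. R (max 0) k \<omega> - expectation (R (max 0) k)) / real n) \<longlonglongrightarrow> 0"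
    by (rule slln) auto
  moreover have "AE \<omega> in M. (\<lambda>n. (\<Sum>k=1..n. R (\<lambda>x. max 0 (- x)) k \<omega> - expectation (R (\<lambda>x. max 0 (- x)) k)) / real n) \<longlonglongrightarrow> 0"
    by (rule slln) auto
  ultimately show ?thesis
  proof eventually_elim
    case (elim \<omega>)
    have "eventually (\<lambda>k. X k \<omega> - R (\<lambda>x. x) k \<omega> = 0) sequentially"
      using eventually_ge_at_top[of n0] by eventually_elim (simp add: R_def)
    then have "(\<lambda>n. (\<Sum>k=1..n. X k \<omega> - R (\<lambda>x. x) k \<omega>) / real n) \<longlonglongrightarrow> 0"
      by (rule cesaro_zero_if_eventually_zero)
    from tendsto_add[OF this tendsto_diff[OF elim]]
    have "(\<lambda>n. ((\<Sum>k=1..n. X k \<omega> - R (\<lambda>x. x) k \<omega>)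
        + ((\<Sum>k=1..n. R (max 0) k \<omega> - expectation (R (max 0) k))
         - (\<Sum>k=1..n. R (\<lambda>x. max 0 (- x)) k \<omega> - expectation (R (\<lambda>x. max 0 (- x)) k)))) / real n) \<longlonglongrightarrow> 0"
      by (simp add: add_divide_distrib diff_divide_distrib)
    also have "(\<lambda>n. (\<Sum>k=1..n. X k \<omega> - R (\<lambda>x. x) k \<omega>)
        + ((\<Sum>k=1..n. R (max 0) k \<omega> - expectation (R (max 0) k))
         - (\<Sum>k=1..n. R (\<lambda>x. max 0 (- x)) k \<omega> - expectation (R (\<lambda>x. max 0 (- x)) k)))) = (\<lambda>n. \<Sum>k=1..n. X k \<omega>)"
    proof
      fix n
      show "(\<Sum>k=1..n. X k \<omega> - R (\<lambda>x. x) k \<omega>)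
        + ((\<Sum>k=1..n. R (max 0) k \<omega> - expectation (R (max 0) k))
         - (\<Sum>k=1..n. R (\<lambda>x. max 0 (- x)) k \<omega> - expectation (R (\<lambda>x. max 0 (- x)) k))) = (\<Sum>k=1..n. X k \<omega>)"
        unfolding mean sum_subtractf[symmetric] sum.distrib[symmetric]
        by (rule sum.cong) (auto simp: R_def max_def)
    qed
    finally show ?case .
  qed
qed

section \<open>Growing powers of dominated variables\<close>

text \<open>
  Kronecker's lemma for nonnegative terms. Here it follows from dominated convergence for series, since
  \<open>b j * c j / b m\<close> is bounded by \<open>c j\<close> for \<open>j \<le> m\<close> and tends to 0 in \<open>m\<close>.
\<close>

lemma weighted_sum_over_last_weight:
  fixes b c :: "nat \<Rightarrow> real"
  assumes "summable c" and c_nonneg: "\<And>j. 0 \<le> c j"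
    and b_pos: "\<And>j. 1 \<le> j \<Longrightarrow> 0 < b j"
    and b_mono: "\<And>j m. 1 \<le> j \<Longrightarrow> j \<le> m \<Longrightarrow> b j \<le> b m"
    and b_lim: "filterlim b at_top sequentially"
  shows "(\<lambda>m. (\<Sum>j=1..m. b j * c j) / b m) \<longlonglongrightarrow> 0"
proof -
  define d where "d j m = (if j \<in> {1..m} then b j * c j / b m else 0)" for j m
  have "(\<lambda>m. d j m) \<longlonglongrightarrow> 0" for j
  proof (rule tendsto_sandwich[OF _ _ tendsto_const])
    show "eventually (\<lambda>m. 0 \<le> d j m) sequentially"
      using b_pos c_nonneg by (auto simp: d_def less_imp_le)
    show "eventually (\<lambda>m. d j m \<le> \<bar>b j * c j\<bar> / b m) sequentially"
      using eventually_ge_at_top[of 1]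
    proof eventually_elim
      case (elim m)
      then show ?case
        using b_pos[of m] by (auto simp: d_def intro!: divide_right_mono)
    qed
    show "(\<lambda>m. \<bar>b j * c j\<bar> / b m) \<longlonglongrightarrow> 0"
      using b_lim by (intro tendsto_divide_0[OF tendsto_const] filterlim_at_top_imp_at_infinity)
  qed
  moreover have "eventually (\<lambda>(j, m). norm (d j m) \<le> c j) (at_top \<times>\<^sub>F sequentially)"
  proof (intro always_eventually allI, clarify)
    fix j m
    show "norm (d j m) \<le> c j"
    proof (cases "j \<in> {1..m}")
      case True
      then have "b j * c j \<le> b m * c j"
        by (intro mult_right_mono b_mono c_nonneg) auto
      then show ?thesis
        using True b_pos[of j] b_pos[of m] c_nonneg[of j] by (simp add: d_def field_simps)
    qed (auto simp: d_def c_nonneg)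
  qed
  ultimately have "(\<lambda>m. suminf (\<lambda>j. d j m)) \<longlonglongrightarrow> suminf (\<lambda>j. 0)"
    using tannerys_theorem[of d "\<lambda>_. 0" sequentially c] \<open>summable c\<close> by auto
  moreover have "suminf (\<lambda>j. d j m) = (\<Sum>j=1..m. b j * c j) / b m" for m
  proof -
    have "suminf (\<lambda>j. d j m) = (\<Sum>j=1..m. d j m)"
      by (rule suminf_finite) (auto simp: d_def)
    then show ?thesis
      by (simp add: d_def sum_divide_distrib)
  qed
  ultimately show ?thesis by simp
qed

text \<open>
  With \<open>x = U j / j\<close> almost surely in \<open>[0, 1)\<close> for large \<open>j\<close>, and exponents at least 2 from some point on,
  \<open>x powr p j \<le> x\<^sup>2\<close>. These squares are summable by \<open>capped_ratio_squares_summable\<close>, and Kronecker's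
  lemma with the weights \<open>j powr p j\<close> concludes. Bounding each term separately by
  \<open>U j \<le> \<epsilon> * j\<close> would leave \<open>m * \<epsilon> powr p m\<close>, which need not vanish when \<open>p\<close> grows slowly.
\<close>

lemma (in cesaro_dominated) sum_growing_powers_negligible:
  fixes p :: "nat \<Rightarrow> real"
  assumes p_pos: "\<And>j. 1 \<le> j \<Longrightarrow> 0 < p j"
    and p_mono: "\<And>j m. 1 \<le> j \<Longrightarrow> j \<le> m \<Longrightarrow> p j \<le> p m"
    and p_lim: "filterlim p at_top sequentially"
  shows "AE \<omega> in M. (\<lambda>m. (\<Sum>j=1..m. U j \<omega> powr p j) / real m powr p m) \<longlonglongrightarrow> 0"
  using capped_ratio_squares_summable eventually_below_index
proof eventually_elim
  case (elim \<omega>)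
  define c where "c j = (U j \<omega> / real j) powr p j" for j
  define b where "b j = real j powr p j" for j
  have p_ge: "eventually (\<lambda>j. C \<le> p j) sequentially" for C
    using p_lim by (simp add: filterlim_at_top)
  have "eventually (\<lambda>j. norm (c j) \<le> (min (U j \<omega> / real j) 1)\<^sup>2) sequentially"
    using elim(2) p_ge[of 2] eventually_gt_at_top[of 0]
  proof eventually_elim
    case (elim j)
    define x where "x = U j \<omega> / real j"
    have x: "0 \<le> x" "x \<le> 1"
      using elim nonneg[of j \<omega>] by (auto simp: x_def field_simps)
    then have "x powr p j \<le> x powr 2"
      using elim powr_mono'[of 2 "p j" x] by simp
    also have "\<dots> = x\<^sup>2"
      using x by (simp add: powr_numeral)
    finally show ?case
      using x by (simp add: c_def flip: x_def)
  qed
  then have "summable c"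
    by (rule summable_comparison_test_ev[OF _ elim(1)])
  moreover have "0 \<le> c j" for j
    by (simp add: c_def)
  moreover have "0 < b j" if "1 \<le> j" for j
    using that by (simp add: b_def)
  moreover have "b j \<le> b m" if "1 \<le> j" "j \<le> m" for j m
  proof -
    have "b j \<le> real m powr p j"
      unfolding b_def using that p_pos[of j] by (intro powr_mono2) auto
    also have "\<dots> \<le> b m"
      unfolding b_def using that p_mono by (intro powr_mono) auto
    finally show ?thesis .
  qed
  moreover have "filterlim b at_top sequentially"
  proof (rule filterlim_at_top_mono[OF filterlim_real_sequentially])
    show "eventually (\<lambda>j. real j \<le> b j) sequentially"
      using p_ge[of 1] eventually_ge_at_top[of 1]
    proof eventually_elim
      case (elim j)
      then show ?case
        using powr_mono[of 1 "p j" "real j"] by (simp add: b_def)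
    qed
  qed
  ultimately have "(\<lambda>m. (\<Sum>j=1..m. b j * c j) / b m) \<longlonglongrightarrow> 0"
    by (rule weighted_sum_over_last_weight)
  moreover have "(\<Sum>j=1..m. b j * c j) = (\<Sum>j=1..m. U j \<omega> powr p j)" for m
    by (rule sum.cong) (auto simp: b_def c_def powr_divide nonneg)
  ultimately show ?case
    by (simp add: b_def)
qed

section \<open>The interleaved sequence\<close>

lemma sum_interleave:
  fixes X Y :: "nat \<Rightarrow> 'a \<Rightarrow> real"
  assumes \<alpha>_01: "\<And>n. n \<ge> 1 \<Longrightarrow> \<alpha> n \<in> {0, 1}"
  shows "(\<Sum>k=1..n. interleave \<alpha> X Y k \<omega>) = (\<Sum>j=1..num_X \<alpha> n. X j \<omega>) + (\<Sum>j=1..num_Y \<alpha> n. Y j \<omega>)"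
proof -
  have num_le: "num_Y \<alpha> n \<le> n" for n
  proof (induction n)
    case (Suc n)
    then show ?case
      using \<alpha>_01[of "Suc n"] by (auto simp: num_Y_def)
  qed (simp add: num_Y_def)
  show ?thesis
  proof (induction n)
    case (Suc n)
    consider "\<alpha> (Suc n) = 0" | "\<alpha> (Suc n) = 1"
      using \<alpha>_01[of "Suc n"] by auto
    then show ?case
    proof cases
      case 1
      then have "num_Y \<alpha> (Suc n) = num_Y \<alpha> n" "num_X \<alpha> (Suc n) = Suc (num_X \<alpha> n)"
        using num_le[of n] by (auto simp: num_Y_def num_X_def Suc_diff_le)
      then show ?thesis
        using Suc 1 by (simp add: interleave_def)
    next
      case 2
      then have "num_Y \<alpha> (Suc n) = Suc (num_Y \<alpha> n)" "num_X \<alpha> (Suc n) = num_X \<alpha> n"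
        by (auto simp: num_Y_def num_X_def)
      then show ?thesis
        using Suc 2 by (simp add: interleave_def)
    qed
  qed (simp add: num_X_def num_Y_def)
qed

theorem theorem1:
  fixes M :: "'a measure"
    and X Y V :: "nat \<Rightarrow> 'a \<Rightarrow> real"
    and a :: "nat \<Rightarrow> real"
    and G :: "real \<Rightarrow> real"
    and \<alpha> :: "nat \<Rightarrow> nat"
    and n0 :: nat
  assumes "prob_space M"
    and X_rv: "\<And>n. n \<ge> 1 \<Longrightarrow> X n \<in> borel_measurable M"
    and Y_rv: "\<And>n. n \<ge> 1 \<Longrightarrow> Y n \<in> borel_measurable M"
    and X_indep: "pairwise (\<lambda>m n. prob_space.indep_var M borel (X m) borel (X n)) {1..}"
    and X_integrable: "\<And>n. n \<ge> 1 \<Longrightarrow> integrable M (X n)"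
    and X_mean: "\<And>n. n \<ge> 1 \<Longrightarrow> (\<integral>\<omega>. X n \<omega> \<partial>M) = 0"
    and n0: "n0 \<ge> 1"
    and X_tail: "(\<integral>\<^sup>+x\<in>{0..}. (SUP n\<in>{n0..}. ennreal
          (1 / real n * (\<Sum>k=n0..n. measure M {\<omega>\<in>space M. \<bar>X k \<omega>\<bar> > x}))) \<partial>lborel) < \<infinity>"
    and a_pos: "\<And>n. n \<ge> 1 \<Longrightarrow> a n > 0"
    and a_decr: "antimono_on {1..} a"
    and a_lim: "a \<longlonglongrightarrow> 0"
    and V_eq: "\<And>n \<omega>. n \<ge> 1 \<Longrightarrow> V n \<omega> = \<bar>Y n \<omega>\<bar> powr a n"
    and V_integrable: "\<And>n. n \<ge> 1 \<Longrightarrow> integrable M (V n)"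
    and G_nonneg: "\<And>t. t \<ge> 0 \<Longrightarrow> G t \<ge> 0"
    and G_decr: "antimono_on {0..} G"
    and V_tail: "\<And>t. t \<ge> 0 \<Longrightarrow> (SUP n\<in>{1..}. measure M {\<omega>\<in>space M. V n \<omega> > t}) \<le> G t"
    and G_integral: "(\<integral>\<^sup>+t\<in>{0..}. ennreal (G t) \<partial>lborel) < \<infinity>"
    and \<alpha>_01: "\<And>n. n \<ge> 1 \<Longrightarrow> \<alpha> n \<in> {0, 1}"
    and Y_inf: "filterlim (num_Y \<alpha>) at_top sequentially"
    and Y_growth: "limsup (\<lambda>n. ereal
          (real (num_Y \<alpha> n) powr (1 / a (num_Y \<alpha> n)) / real n)) < \<infinity>"
  shows "AE \<omega> in M. (\<lambda>n. 1 / real n * (\<Sum>k=1..n. interleave \<alpha> X Y k \<omega>)) \<longlonglongrightarrow> 0"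
proof -
  interpret prob_space M by fact
  have X_part: "AE \<omega> in M. (\<lambda>m. (\<Sum>k=1..m. X k \<omega>) / real m) \<longlonglongrightarrow> 0"
  proof (rule centred_pairwise_indep_slln[OF X_rv _ X_integrable X_mean n0 X_tail])
    show "indep_var borel (X m) borel (X n)" if "1 \<le> m" "1 \<le> n" "m \<noteq> n" for m n
      using pairwiseD[OF X_indep, of m n] that by simp
  qed

  define V0 where "V0 k \<omega> = (if k = 0 then 0 else V k \<omega>)" for k \<omega>
  define H where "H t = ennreal (G t) * indicator {0..} t" for t
  \<comment> \<open>\<open>G\<close> is monotone on the half-line only, so it is extended to the left by a constant to get
    measurability.\<close>
  have "mono (\<lambda>t. - G (max 0 t))"
    using monotone_onD[OF G_decr] by (intro monoI) auto
  then have "(\<lambda>t. - G (max 0 t)) \<in> borel_measurable borel"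
    by (rule borel_measurable_mono)
  then have [measurable]: "(\<lambda>t. G (max 0 t)) \<in> borel_measurable borel"
    by simp
  have H_eq: "H = (\<lambda>t. ennreal (G (max 0 t)) * indicator {0..} t)"
    by (auto simp: H_def fun_eq_iff split: split_indicator)
  have V_meas: "V n \<in> borel_measurable M" if "1 \<le> n" for n
    using V_integrable[OF that] by simp
  interpret V: cesaro_dominated M V0 H
  proof
    show "V0 k \<in> borel_measurable M" for k
      unfolding V0_def[abs_def] using V_meas by (cases "k = 0") auto
    show "0 \<le> V0 k \<omega>" for k \<omega>
      by (cases "k = 0") (auto simp: V0_def V_eq)
    show "H \<in> borel_measurable borel"
      unfolding H_eq by measurable
    show "(\<integral>\<^sup>+t. H t * indicator {0..} t \<partial>lborel) < \<infinity>"
      using G_integral by (simp add: H_def mult.assoc flip: indicator_inter_arith)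
    show "(\<Sum>k=1..n. emeasure M {\<omega>\<in>space M. t < V0 k \<omega>}) \<le> of_nat n * H t" if "0 \<le> t" for n t
    proof -
      have "emeasure M {\<omega>\<in>space M. t < V0 k \<omega>} \<le> H t" if "k \<in> {1..n}" for k
      proof -
        have "prob {\<omega>\<in>space M. V k \<omega> > t} \<le> (SUP n\<in>{1..}. prob {\<omega>\<in>space M. V n \<omega> > t})"
          using that by (intro cSUP_upper bdd_aboveI2[where M = 1]) auto
        then have "prob {\<omega>\<in>space M. V k \<omega> > t} \<le> G t"
          using V_tail[OF \<open>0 \<le> t\<close>] by linarith
        then show ?thesis
          using that \<open>0 \<le> t\<close> by (auto simp: V0_def H_def emeasure_eq_measure intro: ennreal_leI)
      qed
      then have "(\<Sum>k=1..n. emeasure M {\<omega>\<in>space M. t < V0 k \<omega>}) \<le> (\<Sum>k=1..n. H t)"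
        by (rule sum_mono)
      then show ?thesis by simp
    qed
  qed
  have "AE \<omega> in M. (\<lambda>m. (\<Sum>j=1..m. V0 j \<omega> powr (1 / a j)) / real m powr (1 / a m)) \<longlonglongrightarrow> 0"
  proof (rule V.sum_growing_powers_negligible)
    show "0 < 1 / a j" if "1 \<le> j" for j
      using a_pos[OF that] by simp
    show "1 / a j \<le> 1 / a m" if "1 \<le> j" "j \<le> m" for j m
      using a_pos[of m] monotone_onD[OF a_decr, of j m] that by (intro divide_left_mono) auto
    have "eventually (\<lambda>n. 0 < a n) sequentially"
      using eventually_ge_at_top[of 1] by eventually_elim (rule a_pos)
    then have "filterlim (\<lambda>n. inverse (a n)) at_top sequentially"
      using a_lim by (intro filterlim_inverse_at_top)
    then show "filterlim (\<lambda>n. 1 / a n) at_top sequentially"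
      by (simp add: inverse_eq_divide)
  qed
  moreover have "V0 j \<omega> powr (1 / a j) = \<bar>Y j \<omega>\<bar>" if "1 \<le> j" for j \<omega>
    using that a_pos[OF that] by (simp add: V0_def V_eq powr_powr)
  ultimately have Y_part: "AE \<omega> in M. (\<lambda>m. (\<Sum>j=1..m. \<bar>Y j \<omega>\<bar>) / real m powr (1 / a m)) \<longlonglongrightarrow> 0"
    by simp

  obtain C where C: "limsup (\<lambda>n. ereal
          (real (num_Y \<alpha> n) powr (1 / a (num_Y \<alpha> n)) / real n)) < ereal C"
    using ereal_dense2[OF Y_growth] by blast
  then have growth: "eventually (\<lambda>n. real (num_Y \<alpha> n) powr (1 / a (num_Y \<alpha> n)) / real n < C) sequentially"
    using Limsup_lessD[OF C] by simp
  have num_X_le: "num_X \<alpha> n \<le> n" for n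
    by (simp add: num_X_def)
  from X_part Y_part show ?thesis
  proof eventually_elim
    case (elim \<omega>)
    define A where "A m = (\<Sum>j=1..m. \<bar>Y j \<omega>\<bar>) / real m powr (1 / a m)" for m
    have "(\<lambda>n. A (num_Y \<alpha> n)) \<longlonglongrightarrow> 0"
      using filterlim_compose[OF elim(2) Y_inf] by (simp add: A_def)
    then have A: "(\<lambda>n. A (num_Y \<alpha> n) * C) \<longlonglongrightarrow> 0"
      by (rule tendsto_mult_left_zero)
    \<comment> \<open>The weight \<open>m powr (1 / a m)\<close> at \<open>m = num_Y \<alpha> n\<close> is eventually at most \<open>C * n\<close>.\<close>
    have Y_lim: "(\<lambda>n. (\<Sum>j=1..num_Y \<alpha> n. Y j \<omega>) / real n) \<longlonglongrightarrow> 0"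
    proof (rule Lim_null_comparison[OF _ A])
      show "eventually (\<lambda>n. norm ((\<Sum>j=1..num_Y \<alpha> n. Y j \<omega>) / real n) \<le> A (num_Y \<alpha> n) * C) sequentially"
        using growth
      proof eventually_elim
        case (elim n)
        define m where "m = num_Y \<alpha> n"
        have "norm ((\<Sum>j=1..m. Y j \<omega>) / real n) \<le> (\<Sum>j=1..m. \<bar>Y j \<omega>\<bar>) / real n"
          by (simp add: abs_divide divide_right_mono)
        also have "(\<Sum>j=1..m. \<bar>Y j \<omega>\<bar>) = A m * real m powr (1 / a m)"
          by (cases "m = 0") (auto simp: A_def)
        also have "A m * real m powr (1 / a m) / real n = A m * (real m powr (1 / a m) / real n)"
          by simp
        also have "\<dots> \<le> A m * C"
          using elim by (intro mult_left_mono) (auto simp: m_def A_def intro!: divide_nonneg_nonneg sum_nonneg)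
        finally show ?case
          by (simp add: m_def)
      qed
    qed
    have split: "(\<Sum>k=1..n. interleave \<alpha> X Y k \<omega>)
        = (\<Sum>j=1..num_X \<alpha> n. X j \<omega>) + (\<Sum>j=1..num_Y \<alpha> n. Y j \<omega>)" for n
      by (rule sum_interleave) (rule \<alpha>_01)
    from tendsto_add[OF delayed_average_tendsto_zero[OF elim(1) num_X_le] Y_lim]
    show ?case
      unfolding split by (simp add: add_divide_distrib)
  qed
qed

end
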